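(* Let $E\subset \mathbb{R}^2$ be compact and let $s > 0$. Then $\sigma(E,s)=\lambda(E,s)$.
   Context: $\mathcal{H}^1$ denotes one-dimensional Hausdorff measure. For $A\subset\mathbb{R}^2$ and $r>0$, $B(A,r):=\{x\in\mathbb{R}^2:\mathrm{dist}(x,A)\le r\}$ is the closed $r$-neighborhood of $A$, where $\mathrm{dist}(x,A)=\inf\{|x-y|:y\in A\}$ and $|\cdot|$ is the Euclidean norm. The $s$-maximum distance length of a compact set $E\subset\mathbb{R}^2$ is $$\lambda(E,s):=\inf\{\mathcal{H}^1(K): K\subset\mathbb{R}^2 \text{ is closed, connected and } E\subset B(K,s)\}.$$ For a finite (nonempty) set of points $X=\{x_i\}_{i=1}^N\subset\mathbb{R}^2$, a Steiner tree over $X$, denoted $S_X$, is a minimizer of $$\inf\{\mathcal{H}^1(S): S \text{ is closed, connected and } X\subset S\};$$ such minimizers exist. The $s$-spanning length of $E$ is $$\sigma(E,s):=\inf\{\mathcal{H}^1(S_X): X=\{x_i\}_{i=1}^N \text{ a finite set of points in } \mathbb{R}^2,\ B(X,s)\supset E\}.$$ *)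

theory Defs
  imports "HOL-Analysis.Analysis"
begin

text \<open>The diameter function of the library is only meaningful for bounded sets, so boundedness of
  the covering sets is required explicitly. The library's \<open>diameter {} = 0\<close> allows finite covers.\<close>

definition hausdorff_premeasure_1 :: "real \<Rightarrow> 'a::metric_space set \<Rightarrow> ennreal" where
  "hausdorff_premeasure_1 \<delta> A =
     (INF U \<in> {U :: nat \<Rightarrow> 'a set. A \<subseteq> (\<Union>i. U i) \<and> (\<forall>i. bounded (U i) \<and> diameter (U i) \<le> \<delta>)}.
        (\<Sum>i. ennreal (diameter (U i))))"

definition hausdorff_measure_1 :: "'a::metric_space set \<Rightarrow> ennreal" where
  "hausdorff_measure_1 A = (SUP \<delta> \<in> {0<..}. hausdorff_premeasure_1 \<delta> A)"

text \<open>The condition \<open>A \<noteq> {}\<close> encodes the convention that the distance to the empty set is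
  infinite; the library's \<open>infdist x {}\<close> is \<open>0\<close>.\<close>

definition closed_nbhd :: "(real^2) set \<Rightarrow> real \<Rightarrow> (real^2) set" where
  "closed_nbhd A r = {x. A \<noteq> {} \<and> infdist x A \<le> r}"

definition max_distance_length :: "(real^2) set \<Rightarrow> real \<Rightarrow> ennreal" where
  "max_distance_length E s =
     (INF K \<in> {K. closed K \<and> connected K \<and> E \<subseteq> closed_nbhd K s}. hausdorff_measure_1 K)"

definition steiner_tree :: "(real^2) set \<Rightarrow> (real^2) set \<Rightarrow> bool" where
  "steiner_tree X S \<longleftrightarrow>
     closed S \<and> connected S \<and> X \<subseteq> S \<and>
     (\<forall>T. closed T \<and> connected T \<and> X \<subseteq> T \<longrightarrow> hausdorff_measure_1 S \<le> hausdorff_measure_1 T)"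

text \<open>All Steiner trees over the same \<open>X\<close> have the same length, so ranging over all of them
  involves no choice of \<open>S\<^sub>X\<close>.\<close>

definition spanning_length :: "(real^2) set \<Rightarrow> real \<Rightarrow> ennreal" where
  "spanning_length E s =
     Inf {hausdorff_measure_1 S | X S.
            finite X \<and> X \<noteq> {} \<and> E \<subseteq> closed_nbhd X s \<and> steiner_tree X S}"

end

theory Submission
  imports Defs
begin

text \<open>A set \<open>K\<close> competing for the maximum distance length is first replaced by a closed tour of a tree
  through a fine net of \<open>K\<close>, barely longer than \<open>K\<close>; such a tree is read off a nearly optimal cover of
  \<open>K\<close>. The net covers \<open>E\<close> only with radius \<open>s + \<delta>\<close>, and repairing this by spikes of length about \<open>\<delta>\<close> at
  every point of the net would cost a length comparable to that of \<open>K\<close>. But a curve of finite length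
  is almost straight at some scale, and passing from a point near a chord to the better endpoint of
  the chord increases the distance to a given point only to second order. So at this scale spikes of
  small total length at the subdivision points suffice, and their tips form the finite set \<open>X\<close>. Steiner
  trees exist by compactness applied along the Dreyfus--Wagner recursion.\<close>

section \<open>One-dimensional Hausdorff measure\<close>

text \<open>The obstacle is circularity: the scale at which a curve is almost straight depends on
  the curve, the curve is a tour of a net, and the net must be fine compared with that scale.
  Uniformity breaks the circle. Every net of \<open>K\<close> has a tour of parameter length at most
  a fixed \<open>M\<close>, and among enough successive refinements by a factor \<open>q\<close> one
  must add little inscribed length; how many are enough depends on \<open>M\<close> and the
  tolerance alone. So \<delta> can be taken below all candidate steps before the net is chosen. At
  the good scale, with step \<open>h\<close>, there are \<open>M / h\<close> subdivision points
  while \<delta> is at most \<open>h / q\<close>, so the spikes that repair \<delta> cost about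
  \<open>M / q\<close> in total.\<close>

lemma hausdorff_premeasure_1_le:
  assumes "A \<subseteq> (\<Union>i. U i)" "\<And>i. bounded (U i)" "\<And>i. diameter (U i) \<le> \<delta>"
  shows "hausdorff_premeasure_1 \<delta> A \<le> (\<Sum>i. ennreal (diameter (U i)))"
  unfolding hausdorff_premeasure_1_def using assms by (intro INF_lower) auto

lemma hausdorff_premeasure_1_le_measure:
  "\<delta> > 0 \<Longrightarrow> hausdorff_premeasure_1 \<delta> A \<le> hausdorff_measure_1 A"
  unfolding hausdorff_measure_1_def by (intro SUP_upper) auto

lemma hausdorff_measure_1_mono:
  assumes "A \<subseteq> B"
  shows "hausdorff_measure_1 A \<le> hausdorff_measure_1 B"
  unfolding hausdorff_measure_1_def hausdorff_premeasure_1_def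
  using assms by (intro SUP_mono' INF_superset_mono) auto

section \<open>Finite subadditivity\<close>

lemma sum_interleave:
  fixes f g :: "nat \<Rightarrow> 'a::comm_monoid_add"
  shows "(\<Sum>i<2*n. if even i then f (i div 2) else g (i div 2)) = (\<Sum>i<n. f i) + (\<Sum>i<n. g i)"
  by (induction n) (simp_all add: ac_simps)

text \<open>Covers are sequences, so two of them are merged by alternating terms;
  \<open>2 * n\<close> terms of the merged series split exactly into \<open>n\<close> terms of
  each.\<close>

lemma hausdorff_premeasure_1_Un:
  "hausdorff_premeasure_1 \<delta> (A \<union> B) \<le> hausdorff_premeasure_1 \<delta> A + hausdorff_premeasure_1 \<delta> B"
proof -
  define C where "C A = {U :: nat \<Rightarrow> 'a set. A \<subseteq> (\<Union>i. U i) \<and> (\<forall>i. bounded (U i) \<and> diameter (U i) \<le> \<delta>)}"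
    for A
  have *: "hausdorff_premeasure_1 \<delta> (A \<union> B) \<le>
      (\<Sum>i. ennreal (diameter (U i))) + (\<Sum>i. ennreal (diameter (V i)))"
    if U: "U \<in> C A" and V: "V \<in> C B" for U V
  proof -
    define W where "W i = (if even i then U (i div 2) else V (i div 2))" for i
    have "A \<union> B \<subseteq> (\<Union>i. W i)"
    proof
      fix x assume "x \<in> A \<union> B"
      then consider i where "x \<in> U i" | i where "x \<in> V i"
        using U V unfolding C_def by blast
      then show "x \<in> (\<Union>i. W i)"
      proof cases
        case (1 i) then have "x \<in> W (2 * i)" by (simp add: W_def)
        then show ?thesis by blast
      next
        case (2 i) then have "x \<in> W (Suc (2 * i))" by (simp add: W_def)
        then show ?thesis by blast
      qed
    qed
    then have "hausdorff_premeasure_1 \<delta> (A \<union> B) \<le> (\<Sum>i. ennreal (diameter (W i)))"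
      using U V by (intro hausdorff_premeasure_1_le) (auto simp: W_def C_def)
    also have "\<dots> \<le> (\<Sum>i. ennreal (diameter (U i))) + (\<Sum>i. ennreal (diameter (V i)))"
    proof (rule suminf_le_const[OF summableI])
      fix n
      have "(\<Sum>i<n. ennreal (diameter (W i))) \<le> (\<Sum>i<2*n. ennreal (diameter (W i)))"
        by (intro sum_mono2) auto
      also have "\<dots> = (\<Sum>i<2*n. if even i then ennreal (diameter (U (i div 2)))
          else ennreal (diameter (V (i div 2))))"
        by (intro sum.cong) (auto simp: W_def)
      also have "\<dots> = (\<Sum>i<n. ennreal (diameter (U i))) + (\<Sum>i<n. ennreal (diameter (V i)))"
        by (rule sum_interleave)
      also have "\<dots> \<le> (\<Sum>i. ennreal (diameter (U i))) + (\<Sum>i. ennreal (diameter (V i)))"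
        by (intro add_mono sum_le_suminf summableI) auto
      finally show "(\<Sum>i<n. ennreal (diameter (W i))) \<le> \<dots>" .
    qed
    finally show ?thesis .
  qed
  have pm: "hausdorff_premeasure_1 \<delta> A = (INF U \<in> C A. \<Sum>i. ennreal (diameter (U i)))" for A
    by (simp add: hausdorff_premeasure_1_def C_def)
  show ?thesis
  proof (rule ennreal_le_epsilon)
    fix e :: real
    assume fin: "hausdorff_premeasure_1 \<delta> A + hausdorff_premeasure_1 \<delta> B < top" and e: "0 < e"
    have near: "\<exists>U\<in>C A. (\<Sum>i. ennreal (diameter (U i))) < hausdorff_premeasure_1 \<delta> A + ennreal (e / 2)"
      if "hausdorff_premeasure_1 \<delta> A < top" for A
    proof -
      have "hausdorff_premeasure_1 \<delta> A < hausdorff_premeasure_1 \<delta> A + ennreal (e / 2)"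
        using that e by (cases "hausdorff_premeasure_1 \<delta> A" rule: ennreal_cases)
          (auto simp: ennreal_less_iff simp flip: ennreal_plus)
      then show ?thesis
        unfolding pm[of A] INF_less_iff .
    qed
    obtain U V where UV: "U \<in> C A" "V \<in> C B"
      "(\<Sum>i. ennreal (diameter (U i))) < hausdorff_premeasure_1 \<delta> A + ennreal (e / 2)"
      "(\<Sum>i. ennreal (diameter (V i))) < hausdorff_premeasure_1 \<delta> B + ennreal (e / 2)"
      using near[of A] near[of B] fin by (auto simp: less_top)
    have "hausdorff_premeasure_1 \<delta> (A \<union> B) \<le>
        (hausdorff_premeasure_1 \<delta> A + ennreal (e / 2)) + (hausdorff_premeasure_1 \<delta> B + ennreal (e / 2))"
      by (rule order_trans[OF *[OF UV(1,2)]]) (intro add_mono less_imp_le UV)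
    also have "\<dots> = hausdorff_premeasure_1 \<delta> A + hausdorff_premeasure_1 \<delta> B + (ennreal (e / 2) + ennreal (e / 2))"
      by (simp add: ac_simps)
    also have "ennreal (e / 2) + ennreal (e / 2) = ennreal e"
      using e by (simp flip: ennreal_plus)
    finally show "hausdorff_premeasure_1 \<delta> (A \<union> B) \<le>
        hausdorff_premeasure_1 \<delta> A + hausdorff_premeasure_1 \<delta> B + ennreal e" .
  qed
qed

lemma hausdorff_measure_1_Un:
  "hausdorff_measure_1 (A \<union> B) \<le> hausdorff_measure_1 A + hausdorff_measure_1 B"
proof -
  have "hausdorff_premeasure_1 \<delta> (A \<union> B) \<le> hausdorff_measure_1 A + hausdorff_measure_1 B"
    if "\<delta> > 0" for \<delta>
    using hausdorff_premeasure_1_Un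
    by (rule order_trans) (intro add_mono hausdorff_premeasure_1_le_measure that)
  then show ?thesis
    by (subst hausdorff_measure_1_def) (auto intro: SUP_least)
qed

text \<open>Equal pieces have total diameter \<open>dist a b\<close> at every scale. Upper bounds on
  length all start here; lower bounds come from trees drawn through connected sets.\<close>

lemma hausdorff_measure_1_closed_segment:
  fixes a b :: "'a::euclidean_space"
  shows "hausdorff_measure_1 (closed_segment a b) \<le> ennreal (dist a b)"
proof -
  have "hausdorff_premeasure_1 \<delta> (closed_segment a b) \<le> ennreal (dist a b)" if "\<delta> > 0" for \<delta>
  proof -
    obtain n :: nat where n: "dist a b / \<delta> < n" using reals_Archimedean2 by blast
    have n0: "n > 0" using n that zero_le_dist[of a b]
      by (metis divide_nonneg_pos linorder_not_less of_nat_0 gr0I)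
    define U where "U i = (if i < n then linepath a b ` {i / n..(i + 1) / n} else {})" for i :: nat
    have diam: "diameter (U i) \<le> (if i < n then dist a b / n else 0)" for i
    proof (cases "i < n")
      case True
      have "norm (x - y) \<le> dist a b / n" if "x \<in> U i" "y \<in> U i" for x y
      proof -
        from that True obtain t u where t: "t \<in> {i / n..(i + 1) / n}" "x = linepath a b t"
          and u: "u \<in> {i / n..(i + 1) / n}" "y = linepath a b u"
          by (auto simp: U_def)
        have "x - y = (t - u) *\<^sub>R (b - a)"
          unfolding t u by (simp add: linepath_def algebra_simps)
        then have "norm (x - y) = \<bar>t - u\<bar> * dist a b" by (simp add: dist_norm norm_minus_commute)
        also have "\<bar>t - u\<bar> \<le> (i + 1) / n - i / n"
          using t u by (auto simp: abs_le_iff)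
        also have "(i + 1) / n - i / n = 1 / n" by (simp add: add_divide_distrib)
        finally show ?thesis by (simp add: mult_right_mono)
      qed
      then show ?thesis using True by (simp add: diameter_le)
    qed (simp add: U_def)
    have "hausdorff_premeasure_1 \<delta> (closed_segment a b) \<le> (\<Sum>i. ennreal (diameter (U i)))"
    proof (rule hausdorff_premeasure_1_le)
      show "closed_segment a b \<subseteq> (\<Union>i. U i)"
      proof
        fix x assume "x \<in> closed_segment a b"
        then obtain t where t: "t \<in> {0..1}" "x = linepath a b t"
          unfolding linepath_image_01[symmetric] by auto
        show "x \<in> (\<Union>i. U i)"
        \<comment> \<open>At \<open>t = 1\<close> the floor of \<open>t * n\<close> is
          \<open>n\<close>, one past the last piece.\<close>
        proof (cases "t = 1")
          case True
          then have "x \<in> U (n - 1)" using t n0 by (auto simp: U_def divide_simps of_nat_diff)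
          then show ?thesis by blast
        next
          case False
          define i where "i = nat \<lfloor>t * n\<rfloor>"
          have i: "real i \<le> t * n" "t * n < real i + 1"
            using t by (auto simp: i_def)
          have "t * n < n" using t False n0 by auto
          then have "i < n" using i by linarith
          then have "x \<in> U i" using i t n0 by (auto simp: U_def field_simps)
          then show ?thesis by blast
        qed
      qed
      show "bounded (U i)" for i
        unfolding U_def by (auto intro!: compact_imp_bounded compact_continuous_image)
      have "dist a b / n \<le> \<delta>" using n n0 that by (simp add: field_simps)
      then show "diameter (U i) \<le> \<delta>" for i
        using diam[of i] that by (auto split: if_splits)
    qed
    also have "\<dots> \<le> (\<Sum>i. ennreal (if i < n then dist a b / n else 0))"
      by (intro suminf_le summableI ennreal_leI diam)
    also have "\<dots> = (\<Sum>i<n. ennreal (dist a b / n))"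
      by (subst suminf_finite[of "{..<n}"]) auto
    also have "\<dots> = ennreal (dist a b)" using n0
      by (simp add: ennreal_of_nat_eq_real_of_nat flip: ennreal_mult)
    finally show ?thesis .
  qed
  then show ?thesis
    unfolding hausdorff_measure_1_def by (auto intro: SUP_least)
qed

lemma hausdorff_measure_1_singleton [simp]: "hausdorff_measure_1 {a::'a::euclidean_space} = 0"
  using hausdorff_measure_1_closed_segment[of a a] by simp

lemma hausdorff_measure_1_UN:
  fixes A :: "'i \<Rightarrow> 'a::euclidean_space set"
  assumes "finite I"
  shows "hausdorff_measure_1 (\<Union>i\<in>I. A i) \<le> (\<Sum>i\<in>I. hausdorff_measure_1 (A i))"
  using assms
proof induction
  case empty
  then show ?case using hausdorff_measure_1_mono[of "{}" "{0::'a}"] by simp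
next
  case (insert i I)
  then show ?case
    using hausdorff_measure_1_Un[of "A i" "\<Union>i\<in>I. A i"] add_left_mono order_trans
    by (simp, blast)
qed

text \<open>The \<open>V i\<close> thicken the sets of a nearly optimal cover by summable amounts.\<close>

lemma finite_hausdorff_measure_1_cover:
  fixes K :: "'a::metric_space set"
  assumes fin: "hausdorff_measure_1 K = ennreal L" "L \<ge> 0" and \<epsilon>: "\<epsilon> > 0"
  obtains V :: "nat \<Rightarrow> 'a set" and d :: "nat \<Rightarrow> real"
  where "\<And>i. open (V i)" "K \<subseteq> (\<Union>i. V i)"
    "\<And>i x y. x \<in> V i \<Longrightarrow> y \<in> V i \<Longrightarrow> dist x y \<le> d i" "\<And>i. 0 \<le> d i" "\<And>i. d i \<le> \<epsilon>"
    "\<And>I. finite I \<Longrightarrow> (\<Sum>i\<in>I. d i) \<le> L + \<epsilon>"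
proof -
  \<comment> \<open>Half of \<epsilon> pays for the nearly optimal cover and half for the
    thickening: \<open>2 * w i\<close> sums to \<delta>, and each \<open>d i\<close> is at most
    \<open>\<delta> + \<delta> / 2\<close>.\<close>
  define \<delta> where "\<delta> = \<epsilon> / 2"
  have \<delta>: "\<delta> > 0" using \<epsilon> by (simp add: \<delta>_def)
  have "hausdorff_premeasure_1 \<delta> K < ennreal (L + \<delta>)"
    using hausdorff_premeasure_1_le_measure[OF \<delta>, of K] fin \<delta>
    by (metis ennreal_less_iff less_add_same_cancel1 order_le_less_trans)
  then obtain U where U: "K \<subseteq> (\<Union>i. U i)" "\<And>i. bounded (U i)" "\<And>i. diameter (U i) \<le> \<delta>"
    and sumU: "(\<Sum>i. ennreal (diameter (U i))) < ennreal (L + \<delta>)"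
    unfolding hausdorff_premeasure_1_def INF_less_iff by auto
  define w where "w i = \<delta> / 4 * (1/2) ^ i" for i :: nat
  define V where "V i = (\<Union>y\<in>U i. ball y (w i))" for i
  define d where "d i = diameter (U i) + 2 * w i" for i
  have w: "w i > 0" for i using \<delta> by (simp add: w_def)
  have w_le: "w i \<le> \<delta> / 4" for i
    using \<delta> by (simp add: w_def power_le_one)
  have diam0: "0 \<le> diameter (U i)" for i using U by (simp add: diameter_ge_0)
  show thesis
  proof
    show "open (V i)" for i by (auto simp: V_def)
    have "U i \<subseteq> V i" for i using w[of i] by (auto simp: V_def)
    with U(1) show "K \<subseteq> (\<Union>i. V i)" by blast
    show "dist x y \<le> d i" if xy: "x \<in> V i" "y \<in> V i" for i x y
    proof -
      obtain x' y' where *: "x' \<in> U i" "y' \<in> U i" "dist x' x < w i" "dist y' y < w i"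
        using xy by (auto simp: V_def)
      have "dist x' y' \<le> diameter (U i)" using * U by (intro diameter_bounded_bound) auto
      with * show ?thesis unfolding d_def by metric
    qed
    show "0 \<le> d i" for i using diam0[of i] w[of i] by (simp add: d_def)
    show "d i \<le> \<epsilon>" for i using U(3)[of i] w_le[of i] \<delta> by (simp add: d_def \<delta>_def)
    show "(\<Sum>i\<in>I. d i) \<le> L + \<epsilon>" if I: "finite I" for I
    proof -
      have "ennreal (\<Sum>i\<in>I. diameter (U i)) = (\<Sum>i\<in>I. ennreal (diameter (U i)))"
        using diam0 by simp
      also have "\<dots> \<le> (\<Sum>i. ennreal (diameter (U i)))"
        using I by (intro sum_le_suminf summableI) auto
      also note sumU
      finally have 1: "(\<Sum>i\<in>I. diameter (U i)) < L + \<delta>"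
        using diam0 by (simp add: ennreal_less_iff sum_nonneg)
      have "(\<Sum>i\<in>I. w i) \<le> (\<Sum>i. w i)"
        using I w by (intro sum_le_suminf) (auto simp: w_def less_imp_le intro!: summable_mult summable_geometric)
      also have "\<dots> = \<delta> / 2" unfolding w_def
        by (subst suminf_mult) (auto simp: summable_geometric suminf_geometric)
      finally show ?thesis using 1 by (simp add: d_def sum.distrib \<delta>_def flip: sum_distrib_left)
    qed
  qed
qed

section \<open>Minimal trees\<close>

text \<open>Only terminals, root and total length are recorded, because sums of edge lengths are
  what is minimised; overlapping edges count repeatedly. The root need not lie in \<open>Y\<close>,
  so \<open>edge\<close> can introduce Steiner points.\<close>

inductive rooted_tree :: "'a::euclidean_space set \<Rightarrow> 'a \<Rightarrow> real \<Rightarrow> bool" where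
  point: "rooted_tree {p} p 0"
| edge: "rooted_tree Y q l \<Longrightarrow> rooted_tree Y p (dist p q + l)"
| join: "rooted_tree Y p k \<Longrightarrow> rooted_tree Z p l \<Longrightarrow> rooted_tree (Y \<union> Z) p (k + l)"

lemma rooted_tree_nonneg: "rooted_tree Y p l \<Longrightarrow> 0 \<le> l"
  by (induction rule: rooted_tree.induct) auto

lemma rooted_tree_nonempty: "rooted_tree Y p l \<Longrightarrow> Y \<noteq> {}"
  by (induction rule: rooted_tree.induct) auto

lemma rooted_tree_dist_le: "rooted_tree Y p l \<Longrightarrow> y \<in> Y \<Longrightarrow> dist p y \<le> l"
proof (induction rule: rooted_tree.induct)
  case (edge Y q l p)
  then show ?case using dist_triangle[of p y q] by auto
next
  case (join Y p k Z l)
  then show ?case using rooted_tree_nonneg[of Y p k] rooted_tree_nonneg[of Z p l] by auto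
qed auto

lemma rooted_tree_singleton: "rooted_tree {y} p (dist p y)"
  using rooted_tree.edge[OF rooted_tree.point[of y], of p] by simp

lemma rooted_tree_star:
  assumes "finite Y" "Y \<noteq> {}"
  shows "rooted_tree Y p (\<Sum>y\<in>Y. dist p y)"
  using assms
proof (induction rule: finite_ne_induct)
  case (singleton y)
  then show ?case using rooted_tree_singleton by simp
next
  case (insert y Y)
  from rooted_tree.join[OF rooted_tree_singleton[of y p] insert.IH] insert.hyps show ?case by simp
qed

text \<open>Edges before the first branching collapse into one by the triangle inequality. A join
  with one side already equal to \<open>Y\<close> is bypassed by dropping the other side, whose
  length is nonnegative. What remains branches into proper subsets, which makes the recursion over
  \<open>Y\<close> well-founded.\<close>

lemma rooted_tree_split:
  assumes "rooted_tree Y p l"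
  shows "(\<exists>y. Y = {y}) \<or>
    (\<exists>q A B k m. Y = A \<union> B \<and> A \<subset> Y \<and> B \<subset> Y \<and> rooted_tree A q k \<and> rooted_tree B q m \<and>
       dist p q + k + m \<le> l)"
  using assms
proof (induction rule: rooted_tree.induct)
  case (edge Y q l p)
  show ?case
  proof (cases "\<exists>y. Y = {y}")
    case False
    with edge.IH obtain r A B k m where *: "Y = A \<union> B" "A \<subset> Y" "B \<subset> Y" "rooted_tree A r k"
      "rooted_tree B r m" "dist q r + k + m \<le> l" by blast
    moreover have "dist p r + k + m \<le> dist p q + l" using *(6) dist_triangle[of p r q] by linarith
    ultimately show ?thesis by blast
  qed simp
next
  case (join Y p k Z l)
  have "0 \<le> k" "0 \<le> l" using join.hyps rooted_tree_nonneg by auto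
  then have le: "\<And>x. x \<le> k \<Longrightarrow> x \<le> k + l" "\<And>x. x \<le> l \<Longrightarrow> x \<le> k + l" by auto
  consider "Y = Y \<union> Z" | "Z = Y \<union> Z" | "Y \<subset> Y \<union> Z" "Z \<subset> Y \<union> Z" by blast
  then show ?case
  proof cases
    case 1
    have "(\<exists>y. Y = {y}) \<or> (\<exists>q A B k' m. Y = A \<union> B \<and> A \<subset> Y \<and> B \<subset> Y \<and>
        rooted_tree A q k' \<and> rooted_tree B q m \<and> dist p q + k' + m \<le> k + l)"
      using join.IH(1) le by blast
    then show ?thesis unfolding 1[symmetric] .
  next
    case 2
    have "(\<exists>y. Z = {y}) \<or> (\<exists>q A B k' m. Z = A \<union> B \<and> A \<subset> Z \<and> B \<subset> Z \<and>
        rooted_tree A q k' \<and> rooted_tree B q m \<and> dist p q + k' + m \<le> k + l)"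
      using join.IH(2) le by blast
    then show ?thesis unfolding 2[symmetric] .
  next
    case 3
    then show ?thesis
      using join.hyps by (intro disjI2 exI[of _ p] exI[of _ Y] exI[of _ Z] exI[of _ k] exI[of _ l]) auto
  qed
qed auto

text \<open>The Dreyfus--Wagner recursion: splitting off the first branch point \<open>q\<close> reduces the minimisation
  over all trees to one over \<open>q\<close> in a ball and finitely many splittings of \<open>Y\<close>.\<close>

lemma rooted_tree_minimum:
  fixes Y :: "'a::euclidean_space set"
  assumes "finite Y" "Y \<noteq> {}"
  shows "\<exists>l. rooted_tree Y p l \<and> (\<forall>l'. rooted_tree Y p l' \<longrightarrow> l \<le> l')"
  using assms
proof (induction arbitrary: p rule: finite_psubset_induct)
  case (psubset Y)
  show ?case
  proof (cases "\<exists>y. Y = {y}")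
    case True
    then show ?thesis using rooted_tree_singleton rooted_tree_dist_le by blast
  next
    case False
    define D where "D A q = (SOME l. rooted_tree A q l \<and> (\<forall>l'. rooted_tree A q l' \<longrightarrow> l \<le> l'))" for A and q :: 'a
    have D: "rooted_tree A q (D A q)" "\<And>l. rooted_tree A q l \<Longrightarrow> D A q \<le> l"
      if "A \<subset> Y" "A \<noteq> {}" for A q
      using someI_ex[OF psubset.IH[OF that, of q]] unfolding D_def by blast+
    have D_triangle: "D A q \<le> dist q r + D A r" if "A \<subset> Y" "A \<noteq> {}" for A q r
      using D[OF that] rooted_tree.edge by blast
    have D_cont: "continuous_on UNIV (D A)" if A: "A \<subset> Y" "A \<noteq> {}" for A
    proof -
      have "dist (D A q) (D A r) \<le> dist q r" for q r
        using D_triangle[OF A, of q r] D_triangle[OF A, of r q]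
        by (simp add: dist_real_def dist_commute abs_le_iff)
      then show ?thesis
        unfolding continuous_on_iff using order_le_less_trans by blast
    qed
    \<comment> \<open>The star bounds the search: splitting a tree shorter than \<open>l1\<close>
      gives a branch point within \<open>l1\<close> of \<open>p\<close>. On this compact ball the
      cost \<open>F\<close> is continuous because \<open>D\<close> is 1-Lipschitz in the
      root.\<close>
    obtain l1 where l1: "rooted_tree Y p l1" using rooted_tree_star psubset by blast
    define P where "P = {(A, B). Y = A \<union> B \<and> A \<subset> Y \<and> B \<subset> Y \<and> A \<noteq> {} \<and> B \<noteq> {}}"
    define F where "F = (\<lambda>(A, B) q. dist p q + D A q + D B q)"
    have "P \<subseteq> Pow Y \<times> Pow Y" unfolding P_def by blast
    then have "finite P" using psubset.hyps by (simp add: finite_subset)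
    have "\<exists>q\<in>cball p l1. \<forall>r\<in>cball p l1. F s q \<le> F s r" if s: "s \<in> P" for s
    proof -
      obtain A B where "s = (A, B)" "A \<subset> Y" "B \<subset> Y" "A \<noteq> {}" "B \<noteq> {}"
        using s by (auto simp: P_def)
      then have "continuous_on (cball p l1) (F s)"
        unfolding F_def by (simp, intro continuous_intros continuous_on_subset[OF D_cont]) auto
      then show ?thesis
        using rooted_tree_nonneg[OF l1] by (intro continuous_attains_inf) auto
    qed
    then have "\<forall>s\<in>P. \<exists>q. \<forall>r\<in>cball p l1. F s q \<le> F s r" by blast
    then obtain Q where Q: "\<forall>s\<in>P. \<forall>r\<in>cball p l1. F s (Q s) \<le> F s r"
      by (rule bchoice[THEN exE])
    define l0 where "l0 = Min (insert l1 ((\<lambda>s. F s (Q s)) ` P))"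
    have "l0 \<in> insert l1 ((\<lambda>s. F s (Q s)) ` P)"
      unfolding l0_def using \<open>finite P\<close> by (intro Min_in) auto
    moreover have "rooted_tree Y p (F s (Q s))" if s: "s \<in> P" for s
    proof -
      obtain A B where AB: "s = (A, B)" "Y = A \<union> B" "A \<subset> Y" "B \<subset> Y" "A \<noteq> {}" "B \<noteq> {}"
        using s by (auto simp: P_def)
      have "rooted_tree (A \<union> B) (Q s) (D A (Q s) + D B (Q s))"
        using AB by (intro rooted_tree.join D) auto
      from rooted_tree.edge[OF this, of p] show ?thesis using AB by (simp add: F_def ac_simps)
    qed
    ultimately have "rooted_tree Y p l0" using l1 by auto
    moreover have "l0 \<le> l" if l: "rooted_tree Y p l" for l
    proof (cases "l1 \<le> l")
      case True
      have "l0 \<le> l1" unfolding l0_def using \<open>finite P\<close> by (intro Min_le) auto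
      with True show ?thesis by simp
    next
      case l_less: False
      from rooted_tree_split[OF l] False obtain q A B k m where *: "Y = A \<union> B" "A \<subset> Y" "B \<subset> Y"
        "rooted_tree A q k" "rooted_tree B q m" "dist p q + k + m \<le> l" by blast
      have ne: "A \<noteq> {}" "B \<noteq> {}" using *(4,5) rooted_tree_nonempty by auto
      have "dist p q \<le> l1"
        using *(6) l_less rooted_tree_nonneg[OF *(4)] rooted_tree_nonneg[OF *(5)] by linarith
      moreover have P: "(A, B) \<in> P" using * ne unfolding P_def by blast
      ultimately have "F (A, B) (Q (A, B)) \<le> F (A, B) q" using Q by auto
      also have "\<dots> \<le> dist p q + k + m"
        using D(2)[OF *(2) ne(1) *(4)] D(2)[OF *(3) ne(2) *(5)] by (simp add: F_def)
      also have "\<dots> \<le> l" by (rule *)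
      finally have "F (A, B) (Q (A, B)) \<le> l" .
      moreover have "l0 \<le> F (A, B) (Q (A, B))"
        unfolding l0_def using \<open>finite P\<close> P by (intro Min_le) auto
      ultimately show ?thesis by simp
    qed
    ultimately show ?thesis by (intro exI[of _ l0] conjI allI impI)
  qed
qed

text \<open>Curves are extended by their end points to the whole line, so that tours of different lengths share
  one parameter interval.\<close>

definition lipschitz_curve :: "real \<Rightarrow> 'a::metric_space \<Rightarrow> 'a \<Rightarrow> (real \<Rightarrow> 'a) \<Rightarrow> bool" where
  "lipschitz_curve a p q \<gamma> \<longleftrightarrow> 0 \<le> a \<and> (\<forall>s t. dist (\<gamma> s) (\<gamma> t) \<le> \<bar>s - t\<bar>) \<and>
     (\<forall>t\<le>0. \<gamma> t = p) \<and> (\<forall>t\<ge>a. \<gamma> t = q)"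

lemma lipschitz_curve_append:
  assumes "lipschitz_curve a p q \<gamma>" "lipschitz_curve b q r \<beta>"
  obtains \<alpha> where "lipschitz_curve (a + b) p r \<alpha>" "range \<alpha> = range \<gamma> \<union> range \<beta>"
proof
  define \<alpha> where "\<alpha> t = (if t \<le> a then \<gamma> t else \<beta> (t - a))" for t
  have g: "\<And>s t. dist (\<gamma> s) (\<gamma> t) \<le> \<bar>s - t\<bar>" "\<gamma> a = q" "\<And>t. t \<ge> a \<Longrightarrow> \<gamma> t = q" "0 \<le> a"
    and b: "\<And>s t. dist (\<beta> s) (\<beta> t) \<le> \<bar>s - t\<bar>" "\<beta> 0 = q" "\<And>t. t \<le> 0 \<Longrightarrow> \<beta> t = q" "0 \<le> b"
    using assms by (auto simp: lipschitz_curve_def)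
  have across: "dist (\<gamma> s) (\<beta> (t - a)) \<le> \<bar>s - t\<bar>" if "s \<le> a" "a < t" for s t
    using g(1)[of s a] b(1)[of 0 "t - a"] g(2) b(2) that dist_triangle[of "\<gamma> s" "\<beta> (t - a)" q] by auto
  have lip: "dist (\<alpha> s) (\<alpha> t) \<le> \<bar>s - t\<bar>" for s t
    using g(1)[of s t] b(1)[of "s - a" "t - a"] across[of s t] across[of t s]
    by (auto simp: \<alpha>_def dist_commute abs_minus_commute)
  show "lipschitz_curve (a + b) p r \<alpha>"
    unfolding lipschitz_curve_def
  proof (intro conjI allI impI)
    fix t
    show "\<alpha> t = p" if "t \<le> 0"
      using that assms g(4) by (simp add: \<alpha>_def lipschitz_curve_def)
    show "\<alpha> t = r" if "a + b \<le> t"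
    proof (cases "t \<le> a")
      case True
      then have "b = 0" "t = a" using that b(4) by auto
      then show ?thesis using assms g(2) b(2) by (auto simp: \<alpha>_def lipschitz_curve_def)
    next
      case False
      then show ?thesis using that assms by (auto simp: \<alpha>_def lipschitz_curve_def)
    qed
  qed (use g(4) b(4) lip in auto)
  have "\<gamma> t \<in> range \<alpha>" for t
  proof (cases "t \<le> a")
    case True then show ?thesis by (metis \<alpha>_def rangeI)
  next
    case False
    then have "\<gamma> t = \<alpha> a" using g by (simp add: \<alpha>_def)
    then show ?thesis by simp
  qed
  moreover have "\<beta> t \<in> range \<alpha>" for t
  proof (cases "t \<le> 0")
    case True
    then have "\<beta> t = \<alpha> a" using g b by (simp add: \<alpha>_def)
    then show ?thesis by simp
  next
    case False
    then have "\<beta> t = \<alpha> (t + a)" by (simp add: \<alpha>_def)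
    then show ?thesis by simp
  qed
  ultimately show "range \<alpha> = range \<gamma> \<union> range \<beta>"
    by (auto simp: \<alpha>_def)
qed

lemma lipschitz_curve_segment:
  fixes p q :: "'a::euclidean_space"
  obtains \<gamma> where "lipschitz_curve (dist p q) p q \<gamma>" "range \<gamma> \<subseteq> closed_segment p q"
proof
  define d where "d = dist p q"
  \<comment> \<open>Clamping produces the constant ends. The direction \<open>sgn (q - p)\<close> is
    0 when \<open>p = q\<close>, so one formula covers the degenerate segment.\<close>
  define c where "c t = max 0 (min d t)" for t
  define \<gamma> where "\<gamma> t = p + c t *\<^sub>R sgn (q - p)" for t
  have d: "0 \<le> d" "d *\<^sub>R sgn (q - p) = q - p" 
    by (cases "p = q"; simp add: d_def sgn_div_norm dist_norm norm_minus_commute[of p q])+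
  have "dist (\<gamma> s) (\<gamma> t) \<le> \<bar>s - t\<bar>" for s t
  proof -
    have "dist (\<gamma> s) (\<gamma> t) = \<bar>c s - c t\<bar> * norm (sgn (q - p))"
      by (simp add: \<gamma>_def dist_norm flip: scaleR_left_diff_distrib)
    also have "\<dots> \<le> \<bar>c s - c t\<bar> * 1" by (intro mult_left_mono) (auto simp: norm_sgn)
    also have "\<dots> \<le> \<bar>s - t\<bar>" by (auto simp: c_def)
    finally show ?thesis .
  qed
  then show "lipschitz_curve (dist p q) p q \<gamma>"
    using d by (auto simp: lipschitz_curve_def \<gamma>_def c_def simp flip: d_def)
  show "range \<gamma> \<subseteq> closed_segment p q"
  proof clarify
    fix t
    show "\<gamma> t \<in> closed_segment p q"
    proof (cases "d = 0")
      case True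
      then show ?thesis by (simp add: \<gamma>_def c_def)
    next
      case False
      have "sgn (q - p) = (1 / d) *\<^sub>R (q - p)"
        using d False by (metis scaleR_scaleR divide_inverse mult.left_neutral left_inverse scaleR_one)
      then have "\<gamma> t = p + (c t / d) *\<^sub>R (q - p)"
        by (simp add: \<gamma>_def)
      then have "\<gamma> t = (1 - c t / d) *\<^sub>R p + (c t / d) *\<^sub>R q"
        by (simp add: algebra_simps)
      moreover have "0 \<le> c t / d" "c t / d \<le> 1" using d False by (auto simp: c_def)
      ultimately show ?thesis unfolding in_segment by blast
    qed
  qed
qed

text \<open>Each edge is run out and back, so the parameter length is \<open>2 * l\<close>, but both
  runs trace the same segment and the image has measure at most \<open>l\<close>. The first number
  bounds the domain to be subdivided, the second is the length paid.\<close>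

lemma rooted_tree_tour:
  assumes "rooted_tree Y p l"
  shows "\<exists>\<gamma>. lipschitz_curve (2 * l) p p \<gamma> \<and> Y \<subseteq> range \<gamma> \<and>
    hausdorff_measure_1 (range \<gamma>) \<le> ennreal l"
  using assms
proof (induction rule: rooted_tree.induct)
  case (point p)
  show ?case
    by (rule exI[of _ "\<lambda>_. p"]) (auto simp: lipschitz_curve_def)
next
  case (edge Y q l p)
  then obtain \<gamma> where \<gamma>: "lipschitz_curve (2 * l) q q \<gamma>" "Y \<subseteq> range \<gamma>"
    "hausdorff_measure_1 (range \<gamma>) \<le> ennreal l" by auto
  obtain \<alpha> where \<alpha>: "lipschitz_curve (dist p q) p q \<alpha>" "range \<alpha> \<subseteq> closed_segment p q"
    by (rule lipschitz_curve_segment)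
  obtain \<beta> where \<beta>: "lipschitz_curve (dist q p) q p \<beta>" "range \<beta> \<subseteq> closed_segment q p"
    by (rule lipschitz_curve_segment)
  obtain \<alpha>1 where \<alpha>1: "lipschitz_curve (dist p q + 2 * l) p q \<alpha>1" "range \<alpha>1 = range \<alpha> \<union> range \<gamma>"
    by (rule lipschitz_curve_append[OF \<alpha>(1) \<gamma>(1)])
  obtain \<alpha>2 where \<alpha>2: "lipschitz_curve (dist p q + 2 * l + dist q p) p p \<alpha>2"
    "range \<alpha>2 = range \<alpha>1 \<union> range \<beta>"
    by (rule lipschitz_curve_append[OF \<alpha>1(1) \<beta>(1)])
  have "range \<alpha>2 \<subseteq> closed_segment p q \<union> range \<gamma>"
    using \<alpha>(2) \<beta>(2) \<alpha>1(2) \<alpha>2(2) by (auto simp: closed_segment_commute)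
  then have "hausdorff_measure_1 (range \<alpha>2) \<le>
      hausdorff_measure_1 (closed_segment p q) + hausdorff_measure_1 (range \<gamma>)"
    using hausdorff_measure_1_mono hausdorff_measure_1_Un order_trans by blast
  also have "\<dots> \<le> ennreal (dist p q) + ennreal l"
    by (intro add_mono hausdorff_measure_1_closed_segment \<gamma>)
  finally have "hausdorff_measure_1 (range \<alpha>2) \<le> ennreal (dist p q + l)"
    using rooted_tree_nonneg[OF edge.hyps] by simp
  then show ?case using \<alpha>2 \<alpha>1(2) \<gamma>(2)
    by (intro exI[of _ \<alpha>2]) (auto simp: dist_commute algebra_simps)
next
  case (join Y p k Z l)
  then obtain \<gamma> \<beta> where \<gamma>: "lipschitz_curve (2 * k) p p \<gamma>" "Y \<subseteq> range \<gamma>"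
    "hausdorff_measure_1 (range \<gamma>) \<le> ennreal k"
    and \<beta>: "lipschitz_curve (2 * l) p p \<beta>" "Z \<subseteq> range \<beta>"
    "hausdorff_measure_1 (range \<beta>) \<le> ennreal l" by auto
  obtain \<alpha> where \<alpha>: "lipschitz_curve (2 * k + 2 * l) p p \<alpha>" "range \<alpha> = range \<gamma> \<union> range \<beta>"
    by (rule lipschitz_curve_append[OF \<gamma>(1) \<beta>(1)])
  have "hausdorff_measure_1 (range \<alpha>) \<le> ennreal k + ennreal l"
    unfolding \<alpha>(2) using hausdorff_measure_1_Un by (rule order_trans) (intro add_mono \<gamma> \<beta>)
  then have "hausdorff_measure_1 (range \<alpha>) \<le> ennreal (k + l)"
    using rooted_tree_nonneg[OF join.hyps(1)] rooted_tree_nonneg[OF join.hyps(2)] by simp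
  then show ?case using \<alpha> \<gamma>(2) \<beta>(2)
    by (intro exI[of _ \<alpha>]) (auto simp: algebra_simps)
qed

lemma lipschitz_curve_range:
  assumes "lipschitz_curve a p q \<gamma>"
  shows "range \<gamma> = \<gamma> ` {0..a}" "compact (range \<gamma>)" "connected (range \<gamma>)"
proof -
  have \<gamma>: "0 \<le> a" "\<And>s t. dist (\<gamma> s) (\<gamma> t) \<le> \<bar>s - t\<bar>" "\<And>t. t \<le> 0 \<Longrightarrow> \<gamma> t = p" "\<And>t. t \<ge> a \<Longrightarrow> \<gamma> t = q"
    using assms by (auto simp: lipschitz_curve_def)
  have cont: "continuous_on UNIV \<gamma>"
    unfolding continuous_on_iff by (metis \<gamma>(2) dist_real_def order_le_less_trans)
  have "\<gamma> t \<in> \<gamma> ` {0..a}" for t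
  proof -
    consider "t \<le> 0" | "t \<ge> a" | "t \<in> {0..a}" by fastforce
    then show ?thesis
    proof cases
      case 1
      then have "\<gamma> t = \<gamma> 0" using \<gamma>(3) by simp
      then show ?thesis using \<gamma>(1) by auto
    next
      case 2
      then have "\<gamma> t = \<gamma> a" using \<gamma>(4) by simp
      then show ?thesis using \<gamma>(1) by auto
    qed auto
  qed
  then show range: "range \<gamma> = \<gamma> ` {0..a}" by auto
  show "compact (range \<gamma>)"
    unfolding range by (intro compact_continuous_image continuous_on_subset[OF cont]) auto
  show "connected (range \<gamma>)" by (intro connected_continuous_image cont) auto
qed

section \<open>Trees in connected sets of finite length\<close>

text \<open>Adjacency in the intersection graph, restricted to \<open>I\<close> because the
  induction passes to subfamilies and needs chains that stay inside them.\<close>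

definition meeting_pairs :: "('i \<Rightarrow> 'a set) \<Rightarrow> 'i set \<Rightarrow> ('i \<times> 'i) set" where
  "meeting_pairs V I = {(i, j). i \<in> I \<and> j \<in> I \<and> V i \<inter> V j \<noteq> {}}"

lemma meeting_pairs_mono: "I \<subseteq> J \<Longrightarrow> meeting_pairs V I \<subseteq> meeting_pairs V J"
  by (auto simp: meeting_pairs_def)

lemma sym_meeting_pairs: "sym (meeting_pairs V I)"
  by (auto simp: meeting_pairs_def sym_def)

lemma meeting_pairs_rtrancl_in: "(i, j) \<in> (meeting_pairs V I)\<^sup>* \<Longrightarrow> i \<in> I \<Longrightarrow> j \<in> I"
  by (induction rule: rtrancl_induct) (auto simp: meeting_pairs_def)

text \<open>The induction removes the set \<open>V i0\<close> containing the root. A branch leaving \<open>V i0\<close> enters one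
  component of the remaining sets; every further branch costs at most one additional \<open>\<epsilon>\<close> for
  crossing \<open>V i0\<close> again.\<close>

lemma rooted_tree_through_sets:
  fixes V :: "'i \<Rightarrow> 'a::euclidean_space set"
  assumes diam: "\<And>i x y. x \<in> V i \<Longrightarrow> y \<in> V i \<Longrightarrow> dist x y \<le> d i"
    and d: "\<And>i. 0 \<le> d i" "\<And>i. d i \<le> \<epsilon>"
    and "finite I" "i0 \<in> I" "\<And>i. i \<in> I \<Longrightarrow> (i0, i) \<in> (meeting_pairs V I)\<^sup>*"
    and "p \<in> V i0" "finite Y" "Y \<noteq> {}" "Y \<subseteq> (\<Union>i\<in>I. V i)"
  shows "\<exists>l. rooted_tree Y p l \<and> l \<le> (\<Sum>i\<in>I. d i) + (real (card Y) - 1) * \<epsilon>"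
  using assms(4-)
proof (induction arbitrary: i0 p Y rule: finite_psubset_induct)
  case (psubset I)
  have card_pos: "1 \<le> real (card Y)" if "finite Y" "Y \<noteq> {}" for Y :: "'a set"
  proof -
    have "card Y > 0" using that by (simp add: card_gt_0_iff)
    then show ?thesis by linarith
  qed
  show ?case
  proof (cases "Y \<subseteq> V i0")
    case True
    \<comment> \<open>One branch of the star is charged to \<open>d i0\<close>, the others to
      \<epsilon>.\<close>
    have "(\<Sum>y\<in>Y. dist p y) \<le> real (card Y) * d i0"
      using True psubset.prems diam by (intro sum_bounded_above) auto
    also have "\<dots> = d i0 + (real (card Y) - 1) * d i0" by (simp add: algebra_simps)
    also have "\<dots> \<le> (\<Sum>i\<in>I. d i) + (real (card Y) - 1) * \<epsilon>"
      using psubset.prems psubset.hyps d card_pos[of Y]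
      by (intro add_mono mult_left_mono member_le_sum) auto
    finally show ?thesis
      using rooted_tree_star psubset.prems by blast
  next
    case False
    then obtain y j where y: "y \<in> Y" "y \<notin> V i0" and j: "j \<in> I" "y \<in> V j"
      using psubset.prems by blast
    have "j \<noteq> i0" using y j by auto
    \<comment> \<open>\<open>C\<close> is the component of \<open>j\<close> once \<open>i0\<close>
      is deleted. A chain from \<open>i0\<close> to \<open>j\<close> can enter \<open>C\<close> only
      from \<open>i0\<close>, so some set of \<open>C\<close> meets \<open>V i0\<close>; a common
      point \<open>q\<close> roots the tree for the terminals in \<open>C\<close>.\<close>
    define R where "R = meeting_pairs V (I - {i0})"
    define C where "C = {i. (j, i) \<in> R\<^sup>*}"
    have C_sub: "C \<subseteq> I - {i0}"
      using meeting_pairs_rtrancl_in[of j _ V "I - {i0}"] \<open>j \<noteq> i0\<close> j by (auto simp: C_def R_def)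
    have jC: "j \<in> C" by (simp add: C_def)
    have R_sym: "(b, a) \<in> R" if "(a, b) \<in> R" for a b
      using that by (auto simp: R_def meeting_pairs_def)
    have C_closed: "b \<in> C" if "a \<in> C" "b \<in> I - {i0}" "V a \<inter> V b \<noteq> {}" for a b
    proof -
      have "(a, b) \<in> R" using that C_sub by (auto simp: R_def meeting_pairs_def)
      then show ?thesis using that(1) by (auto simp: C_def intro: rtrancl_into_rtrancl)
    qed
    have "\<exists>i1\<in>C. V i0 \<inter> V i1 \<noteq> {}"
    proof (rule ccontr)
      assume contra: "\<not> ?thesis"
      have "i \<notin> C" if "(i0, i) \<in> (meeting_pairs V I)\<^sup>*" for i
        using that
      proof (induction rule: rtrancl_induct)
        case base
        then show ?case using C_sub by auto
      next
        case (step a b)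
        show ?case
        proof
          assume "b \<in> C"
          then have "a \<noteq> i0" using contra step by (auto simp: meeting_pairs_def)
          then have "a \<in> C"
            using C_closed[OF \<open>b \<in> C\<close>, of a] step by (auto simp: meeting_pairs_def)
          then show False using step by simp
        qed
      qed
      then show False using jC psubset.prems j by blast
    qed
    then obtain i1 q where i1: "i1 \<in> C" and q: "q \<in> V i0" "q \<in> V i1" by blast
    define Y1 where "Y1 = Y \<inter> (\<Union>i\<in>C. V i)"
    define Y2 where "Y2 = Y - Y1"
    have Y: "Y = Y1 \<union> Y2" "finite Y1" "finite Y2" "Y1 \<noteq> {}" "card Y = card Y1 + card Y2"
      using psubset.prems y j jC
      by (auto simp: Y1_def Y2_def simp flip: card_Un_disjoint intro!: arg_cong[of _ _ card])
    have "\<exists>l. rooted_tree Y1 q l \<and> l \<le> (\<Sum>i\<in>C. d i) + (real (card Y1) - 1) * \<epsilon>"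
    proof (rule psubset.IH)
      show "C \<subset> I" using C_sub psubset.prems by blast
      show "(i1, i) \<in> (meeting_pairs V C)\<^sup>*" if "i \<in> C" for i
      proof -
        have reach: "(j, i) \<in> (meeting_pairs V C)\<^sup>*" if "(j, i) \<in> R\<^sup>*" for i
          using that
        proof (induction rule: rtrancl_induct)
          case (step a b)
          then have "(a, b) \<in> meeting_pairs V C"
            using C_closed[of a b] by (auto simp: C_def R_def meeting_pairs_def)
          then show ?case using step by (meson rtrancl_into_rtrancl)
        qed simp
        have "(j, i1) \<in> (meeting_pairs V C)\<^sup>*" "(j, i) \<in> (meeting_pairs V C)\<^sup>*"
          using reach i1 \<open>i \<in> C\<close> by (auto simp: C_def)
        moreover have "sym ((meeting_pairs V C)\<^sup>*)"
          by (intro sym_rtrancl sym_meeting_pairs)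
        ultimately show ?thesis by (meson rtrancl_trans symD)
      qed
    qed (use i1 q Y in \<open>auto simp: Y1_def\<close>)
    then obtain l1 where l1: "rooted_tree Y1 q l1" "l1 \<le> (\<Sum>i\<in>C. d i) + (real (card Y1) - 1) * \<epsilon>"
      by blast
    have t1: "rooted_tree Y1 p (dist p q + l1)" by (intro rooted_tree.edge l1)
    have pq: "dist p q \<le> d i0" using diam q psubset.prems by blast
    have sum_I: "(\<Sum>i\<in>I. d i) = (\<Sum>i\<in>C. d i) + (\<Sum>i\<in>I - C. d i)"
      using C_sub psubset.hyps by (subst sum.subset_diff[of C I]) (auto simp: add.commute)
    have d_i0: "d i0 \<le> (\<Sum>i\<in>I - C. d i)"
      using psubset.prems psubset.hyps d C_sub by (intro member_le_sum) auto
    show ?thesis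
    proof (cases "Y2 = {}")
      case True
      \<comment> \<open>With no terminals left over, the crossing is charged to the term
        \<open>d i0\<close> of the sum over \<open>I - C\<close>.\<close>
      have "dist p q + l1 \<le> (\<Sum>i\<in>I. d i) + (real (card Y) - 1) * \<epsilon>"
        using l1 pq sum_I d_i0 Y(5) True by simp
      then show ?thesis using t1 True Y(1) by auto
    next
      case False
      have "\<exists>l. rooted_tree Y2 p l \<and> l \<le> (\<Sum>i\<in>I - C. d i) + (real (card Y2) - 1) * \<epsilon>"
      proof (rule psubset.IH)
        show "I - C \<subset> I" using jC j by blast
        show "(i0, i) \<in> (meeting_pairs V (I - C))\<^sup>*" if "i \<in> I - C" for i
        proof -
          have "i \<in> C \<or> (i0, i) \<in> (meeting_pairs V (I - C))\<^sup>*"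
            if "(i0, i) \<in> (meeting_pairs V I)\<^sup>*" for i
            using that
          proof (induction rule: rtrancl_induct)
            case (step a b)
            show ?case
            proof (cases "b \<in> C \<or> b = i0")
              case False
              then have "a \<notin> C" using C_closed[of a b] step by (auto simp: meeting_pairs_def)
              then have "(i0, a) \<in> (meeting_pairs V (I - C))\<^sup>*" "(a, b) \<in> meeting_pairs V (I - C)"
                using False step by (auto simp: meeting_pairs_def)
              then show ?thesis by (meson rtrancl_into_rtrancl)
            qed auto
          qed simp
          then show ?thesis using psubset.prems that by blast
        qed
        show "Y2 \<subseteq> (\<Union>i\<in>I - C. V i)"
          using psubset.prems by (auto simp: Y1_def Y2_def)
      qed (use psubset.prems C_sub Y False in auto)
      then obtain l2 where l2: "rooted_tree Y2 p l2" "l2 \<le> (\<Sum>i\<in>I - C. d i) + (real (card Y2) - 1) * \<epsilon>"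
        by blast
      have "rooted_tree Y p (dist p q + l1 + l2)"
        unfolding Y(1) by (intro rooted_tree.join t1 l2)
      \<comment> \<open>Here the sum over \<open>I - C\<close> is spent on \<open>Y2\<close>, so the
        crossing costs a further \<epsilon>. The count closes because
        \<open>(card Y1 - 1) + (card Y2 - 1) + 1 = card Y - 1\<close>.\<close>
      moreover have "dist p q + l1 + l2 \<le> (\<Sum>i\<in>I. d i) + (real (card Y) - 1) * \<epsilon>"
        using l1 l2 pq d(2)[of i0] by (simp add: sum_I Y(5) algebra_simps)
      ultimately show ?thesis by blast
    qed
  qed
qed

text \<open>A chain visits finitely many sets. This supplies the finite family for the induction at
  a stage where \<open>K\<close> is not known to be compact: its boundedness will itself be deduced
  from trees.\<close>

lemma rtrancl_meeting_pairs_finite: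
  assumes "(i0, j) \<in> (meeting_pairs V UNIV)\<^sup>*"
  shows "\<exists>I. finite I \<and> i0 \<in> I \<and> j \<in> I \<and> (\<forall>i\<in>I. (i0, i) \<in> (meeting_pairs V I)\<^sup>*)"
  using assms
proof (induction rule: rtrancl_induct)
  case base
  then show ?case by (intro exI[of _ "{i0}"]) auto
next
  case (step a b)
  then obtain I where I: "finite I" "i0 \<in> I" "a \<in> I" "\<And>i. i \<in> I \<Longrightarrow> (i0, i) \<in> (meeting_pairs V I)\<^sup>*"
    by auto
  have *: "(i0, i) \<in> (meeting_pairs V (insert b I))\<^sup>*" if "i \<in> I" for i
    using I(4)[OF that] rtrancl_mono[OF meeting_pairs_mono[of I "insert b I" V]] by blast
  have "(a, b) \<in> meeting_pairs V (insert b I)"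
    using step I by (auto simp: meeting_pairs_def)
  then have "(i0, b) \<in> (meeting_pairs V (insert b I))\<^sup>*"
    using *[OF I(3)] by (meson rtrancl_into_rtrancl)
  then show ?case using * I by (intro exI[of _ "insert b I"]) auto
qed

text \<open>Chains of an open cover link any two points of a connected set, so finitely many
  terminals hang together in a finite subfamily whose diameters sum to little more than the measure.
  The edges themselves may leave \<open>K\<close>.\<close>

lemma rooted_tree_le_hausdorff_measure_1:
  fixes K :: "'a::euclidean_space set"
  assumes K: "connected K" "hausdorff_measure_1 K = ennreal L" "0 \<le> L"
    and p: "p \<in> K" and Y: "finite Y" "Y \<noteq> {}" "Y \<subseteq> K" and "e > 0"
  shows "\<exists>l. rooted_tree Y p l \<and> l \<le> L + e"
proof -
  \<comment> \<open>One \<epsilon> is lost in the cover and \<open>card Y - 1\<close> in the tree,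
    together \<open>e\<close>.\<close>
  define \<epsilon> where "\<epsilon> = e / real (card Y)"
  have card: "real (card Y) > 0" using Y by (simp add: card_gt_0_iff)
  have \<epsilon>: "\<epsilon> > 0" using \<open>e > 0\<close> card by (simp add: \<epsilon>_def)
  obtain V :: "nat \<Rightarrow> 'a set" and d where V: "\<And>i. open (V i)" "K \<subseteq> (\<Union>i. V i)"
    and diam: "\<And>i x y. x \<in> V i \<Longrightarrow> y \<in> V i \<Longrightarrow> dist x y \<le> d i" and d: "\<And>i. 0 \<le> d i" "\<And>i. d i \<le> \<epsilon>"
    and sum_d: "\<And>I. finite I \<Longrightarrow> (\<Sum>i\<in>I. d i) \<le> L + \<epsilon>"
    using finite_hausdorff_measure_1_cover[OF K(2,3) \<epsilon>] by metis
  obtain i0 where i0: "p \<in> V i0" using V p by blast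
  define R where "R = (meeting_pairs V UNIV)\<^sup>*"
  \<comment> \<open>Otherwise the sets reachable from \<open>i0\<close> and the remaining ones have
    disjoint open unions that separate \<open>p\<close> from \<open>y\<close> in
    \<open>K\<close>.\<close>
  have reach: "\<exists>j. y \<in> V j \<and> (i0, j) \<in> R" if y: "y \<in> K" for y
  proof (rule ccontr)
    assume contra: "\<not> ?thesis"
    define A where "A = (\<Union>j\<in>{j. (i0, j) \<in> R}. V j)"
    define B where "B = (\<Union>j\<in>{j. (i0, j) \<notin> R}. V j)"
    have "A \<inter> B = {}"
    proof (rule ccontr)
      assume "A \<inter> B \<noteq> {}"
      then obtain i j where ij: "(i0, i) \<in> R" "(i0, j) \<notin> R" "V i \<inter> V j \<noteq> {}"
        by (auto simp: A_def B_def)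
      have "(i, j) \<in> meeting_pairs V UNIV" using ij(3) by (simp add: meeting_pairs_def)
      with ij(1) have "(i0, j) \<in> R" unfolding R_def by (rule rtrancl_into_rtrancl)
      then show False using ij(2) by contradiction
    qed
    moreover have "open A" "open B" using V by (auto simp: A_def B_def)
    moreover have "K \<subseteq> A \<union> B" using V(2) unfolding A_def B_def by blast
    moreover have "p \<in> A" using i0 by (auto simp: A_def R_def)
    moreover have "y \<in> B" using contra V(2) y unfolding B_def by blast
    ultimately show False using connectedD[OF K(1), of A B] p y by blast
  qed
  have "\<exists>I. finite I \<and> i0 \<in> I \<and> y \<in> (\<Union>i\<in>I. V i) \<and> (\<forall>i\<in>I. (i0, i) \<in> (meeting_pairs V I)\<^sup>*)"
    if y: "y \<in> Y" for y
  proof -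
    have "y \<in> K" using y Y(3) by blast
    then obtain j where j: "y \<in> V j" "(i0, j) \<in> R" using reach[of y] by auto
    obtain I where "finite I" "i0 \<in> I" "j \<in> I" "\<forall>i\<in>I. (i0, i) \<in> (meeting_pairs V I)\<^sup>*"
      using rtrancl_meeting_pairs_finite[OF j(2)[unfolded R_def]] by auto
    then show ?thesis using j(1) by (intro exI[of _ I]) auto
  qed
  then obtain J where J: "\<And>y. y \<in> Y \<Longrightarrow> finite (J y) \<and> i0 \<in> J y \<and> y \<in> (\<Union>i\<in>J y. V i) \<and>
      (\<forall>i\<in>J y. (i0, i) \<in> (meeting_pairs V (J y))\<^sup>*)"
    by (metis (no_types, lifting))
  define I where "I = (\<Union>y\<in>Y. J y)"
  have "\<exists>l. rooted_tree Y p l \<and> l \<le> (\<Sum>i\<in>I. d i) + (real (card Y) - 1) * \<epsilon>"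
  proof (rule rooted_tree_through_sets[OF diam d])
    show "finite I" using J Y by (auto simp: I_def)
    show "i0 \<in> I" using J Y by (auto simp: I_def)
    show "(i0, i) \<in> (meeting_pairs V I)\<^sup>*" if i: "i \<in> I" for i
    proof -
      obtain y where y: "y \<in> Y" "i \<in> J y" using i by (auto simp: I_def)
      then have "(i0, i) \<in> (meeting_pairs V (J y))\<^sup>*" using J by blast
      moreover have "meeting_pairs V (J y) \<subseteq> meeting_pairs V I"
        using y by (intro meeting_pairs_mono) (auto simp: I_def)
      ultimately show ?thesis using rtrancl_mono by blast
    qed
    show "Y \<subseteq> (\<Union>i\<in>I. V i)" using J unfolding I_def by blast
  qed (use i0 Y in auto)
  then obtain l where l: "rooted_tree Y p l" "l \<le> (\<Sum>i\<in>I. d i) + (real (card Y) - 1) * \<epsilon>"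
    by blast
  have "finite I" using J Y by (auto simp: I_def)
  then have "l \<le> L + \<epsilon> + (real (card Y) - 1) * \<epsilon>" using l sum_d[of I] by linarith
  also have "\<dots> = L + e" using card by (simp add: \<epsilon>_def field_simps)
  finally show ?thesis using l by blast
qed

section \<open>Existence of Steiner trees and the inequality \<lambda> \<le> \<sigma>\<close>

lemma steiner_tree_exists:
  fixes X :: "(real^2) set"
  assumes X: "finite X" "X \<noteq> {}"
  shows "\<exists>S. steiner_tree X S"
proof -
  obtain p where p: "p \<in> X" using X by blast
  obtain l where l: "rooted_tree X p l" "\<And>l'. rooted_tree X p l' \<Longrightarrow> l \<le> l'"
    using rooted_tree_minimum[OF X] by blast
  obtain \<gamma> where \<gamma>: "lipschitz_curve (2 * l) p p \<gamma>" "X \<subseteq> range \<gamma>"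
    "hausdorff_measure_1 (range \<gamma>) \<le> ennreal l"
    using rooted_tree_tour[OF l(1)] by blast
  \<comment> \<open>A competitor \<open>T\<close> of finite measure contains \<open>X\<close> and
    the root \<open>p\<close>, hence yields trees over \<open>X\<close> longer than its measure by
    at most any given \<open>e\<close>; so \<open>l\<close> is at most that measure.\<close>
  have "hausdorff_measure_1 (range \<gamma>) \<le> hausdorff_measure_1 T"
    if T: "closed T" "connected T" "X \<subseteq> T" for T
  proof (cases "hausdorff_measure_1 T" rule: ennreal_cases)
    case (real L)
    have "l \<le> L + e" if "e > 0" for e
      using rooted_tree_le_hausdorff_measure_1[OF T(2) real(2,1) _ X T(3) that, of p] l(2) p T(3)
      by force
    then have "l \<le> L" by (rule field_le_epsilon)
    then show ?thesis using \<gamma>(3) real by (metis ennreal_leI order_trans)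
  qed simp
  then have "steiner_tree X (range \<gamma>)"
    using lipschitz_curve_range[OF \<gamma>(1)] \<gamma>(2) by (auto simp: steiner_tree_def compact_imp_closed)
  then show ?thesis by blast
qed

lemma spanning_length_le:
  assumes "finite X" "X \<noteq> {}" "E \<subseteq> closed_nbhd X s" "closed T" "connected T" "X \<subseteq> T"
  shows "spanning_length E s \<le> hausdorff_measure_1 T"
proof -
  obtain S where S: "steiner_tree X S" using steiner_tree_exists assms by blast
  then have "spanning_length E s \<le> hausdorff_measure_1 S"
    unfolding spanning_length_def using assms by (intro Inf_lower) blast
  also have "\<dots> \<le> hausdorff_measure_1 T" using S assms by (simp add: steiner_tree_def)
  finally show ?thesis .
qed

lemma max_distance_length_le_spanning_length:
  "max_distance_length E s \<le> spanning_length E s"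
  unfolding spanning_length_def
proof (rule Inf_greatest, clarify)
  fix X S :: "(real^2) set"
  assume X: "finite X" "X \<noteq> {}" "E \<subseteq> closed_nbhd X s" "steiner_tree X S"
  then have S: "closed S" "connected S" "X \<subseteq> S" by (auto simp: steiner_tree_def)
  have "closed_nbhd X s \<subseteq> closed_nbhd S s"
    using infdist_mono[OF S(3) X(2)] X(2) S(3) by (auto simp: closed_nbhd_def intro: order_trans)
  with X S show "max_distance_length E s \<le> hausdorff_measure_1 S"
    unfolding max_distance_length_def by (intro INF_lower) auto
qed

section \<open>Subdivision of curves\<close>

text \<open>If the path from \<open>A\<close> to \<open>B\<close> through the origin is hardly longer than the chord, then \<open>A\<close> and \<open>B\<close>
  lie in almost opposite directions, so to first order one of them is no farther from \<open>w\<close> than the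
  origin is. In the proof, weighting the two squared distances by \<open>norm B\<close> and \<open>norm A\<close> nearly cancels
  their first-order terms.\<close>

lemma near_endpoint:
  fixes A B w :: "'a::real_inner"
  assumes "0 \<le> \<sigma>" and \<sigma>: "(norm A + norm B)\<^sup>2 - (norm (A - B))\<^sup>2 \<le> \<sigma>\<^sup>2"
  defines "Q \<equiv> (norm w)\<^sup>2 + norm w * \<sigma> + ((norm A + norm B) / 2)\<^sup>2"
  shows "(norm (w - A))\<^sup>2 \<le> Q \<or> (norm (w - B))\<^sup>2 \<le> Q"
proof (cases "norm A + norm B = 0")
  case True
  then have "A = 0" using norm_ge_zero[of A] norm_ge_zero[of B] by (auto simp: add_nonneg_eq_0_iff)
  then show ?thesis using \<open>0 \<le> \<sigma>\<close> by (simp add: Q_def)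
next
  case False
  define a b where "a = norm A" and "b = norm B"
  define Z where "Z = b *\<^sub>R A + a *\<^sub>R B"
  have ab: "0 \<le> a" "0 \<le> b" "0 < a + b"
    using False norm_ge_zero[of A] norm_ge_zero[of B] unfolding a_def b_def by linarith+
  have AA: "A \<bullet> A = a\<^sup>2" "B \<bullet> B = b\<^sup>2" by (auto simp: a_def b_def power2_norm_eq_inner)
  have prod: "a * b \<le> ((a + b) / 2)\<^sup>2"
    using sum_squares_bound[of a b] by (simp add: power2_eq_square field_simps)
  have chord: "(norm (A - B))\<^sup>2 = a\<^sup>2 + b\<^sup>2 - 2 * (A \<bullet> B)"
    by (simp add: power2_norm_eq_inner inner_diff_left inner_diff_right inner_commute AA)
  \<comment> \<open>\<open>Z\<close> vanishes when \<open>A\<close> and \<open>B\<close> point in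
    opposite directions; its squared norm is exactly \<open>a * b\<close> times the excess bounded
    by \<open>\<sigma>\<^sup>2\<close>.\<close>
  have "(norm Z)\<^sup>2 = b * b * (A \<bullet> A) + 2 * (a * b * (A \<bullet> B)) + a * a * (B \<bullet> B)"
    unfolding power2_norm_eq_inner Z_def
    by (simp add: inner_add_left inner_add_right inner_commute algebra_simps)
  also have "\<dots> = a * b * ((a + b)\<^sup>2 - (norm (A - B))\<^sup>2)"
    unfolding AA chord by (simp add: power2_eq_square algebra_simps)
  also have "\<dots> \<le> ((a + b) / 2)\<^sup>2 * \<sigma>\<^sup>2"
  proof -
    have "a * b * ((a + b)\<^sup>2 - (norm (A - B))\<^sup>2) \<le> a * b * \<sigma>\<^sup>2"
      using \<sigma> ab by (intro mult_left_mono) (auto simp: a_def b_def)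
    also have "\<dots> \<le> ((a + b) / 2)\<^sup>2 * \<sigma>\<^sup>2" using prod by (intro mult_right_mono) auto
    finally show ?thesis .
  qed
  finally have "(norm Z)\<^sup>2 \<le> ((a + b) / 2 * \<sigma>)\<^sup>2" by (simp only: power_mult_distrib)
  then have Z: "norm Z \<le> (a + b) / 2 * \<sigma>"
    using ab \<open>0 \<le> \<sigma>\<close> by (intro power2_le_imp_le[of "norm Z"]) auto
  have "b * (norm (w - A))\<^sup>2 + a * (norm (w - B))\<^sup>2 =
      (a + b) * (norm w)\<^sup>2 - 2 * (w \<bullet> Z) + a * b * (a + b)"
    unfolding power2_norm_eq_inner Z_def
    by (simp add: inner_add_right inner_diff_left inner_diff_right inner_commute AA
        power2_eq_square algebra_simps)
  also have "\<dots> \<le> (a + b) * (norm w)\<^sup>2 + 2 * (norm w * ((a + b) / 2 * \<sigma>)) + ((a + b) / 2)\<^sup>2 * (a + b)"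
  proof -
    have "- (w \<bullet> Z) \<le> norm w * norm Z" using Cauchy_Schwarz_ineq2[of w Z] by linarith
    also have "\<dots> \<le> norm w * ((a + b) / 2 * \<sigma>)" using Z by (intro mult_left_mono) auto
    finally show ?thesis using mult_right_mono[OF prod, of "a + b"] ab by linarith
  qed
  also have "\<dots> = b * Q + a * Q" by (simp add: Q_def a_def b_def field_simps)
  finally have *: "b * (norm (w - A))\<^sup>2 + a * (norm (w - B))\<^sup>2 \<le> b * Q + a * Q" .
  show ?thesis
  proof (rule ccontr)
    assume "\<not> ?thesis"
    then have less: "Q < (norm (w - A))\<^sup>2" "Q < (norm (w - B))\<^sup>2" by auto
    then have "b * Q \<le> b * (norm (w - A))\<^sup>2" "a * Q \<le> a * (norm (w - B))\<^sup>2"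
      using ab by (auto intro!: mult_left_mono)
    \<comment> \<open>One of the weights may be zero, but not both.\<close>
    moreover have "b * Q < b * (norm (w - A))\<^sup>2 \<or> a * Q < a * (norm (w - B))\<^sup>2"
      using ab less by (cases "b > 0") auto
    ultimately show False using * by linarith
  qed
qed

section \<open>Inscribed polygons under refinement\<close>

definition inscribed_length :: "(real \<Rightarrow> 'a::metric_space) \<Rightarrow> real \<Rightarrow> nat \<Rightarrow> real" where
  "inscribed_length \<gamma> M n = (\<Sum>i<n. dist (\<gamma> (M * real i / real n)) (\<gamma> (M * real (Suc i) / real n)))"

lemma inscribed_length_nonneg: "0 \<le> inscribed_length \<gamma> M n"
  by (simp add: inscribed_length_def sum_nonneg)

lemma inscribed_length_le:
  assumes "\<And>s t. dist (\<gamma> s) (\<gamma> t) \<le> \<bar>s - t\<bar>" "0 \<le> M" "0 < n"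
  shows "inscribed_length \<gamma> M n \<le> M"
proof -
  have "inscribed_length \<gamma> M n \<le> (\<Sum>i<n. M / real n)"
    unfolding inscribed_length_def
  proof (rule sum_mono)
    fix i
    have "M * real (Suc i) / real n = M * real i / real n + M / real n" by (simp add: algebra_simps add_divide_distrib)
    then show "dist (\<gamma> (M * real i / real n)) (\<gamma> (M * real (Suc i) / real n)) \<le> M / real n"
      using assms(1)[of "M * real i / real n" "M * real (Suc i) / real n"] assms(2) by simp
  qed
  then show ?thesis using assms(3) by simp
qed

lemma dist_le_sum_dist:
  fixes f :: "nat \<Rightarrow> 'a::metric_space"
  assumes "a \<le> b"
  shows "dist (f a) (f b) \<le> (\<Sum>j\<in>{a..<b}. dist (f j) (f (Suc j)))"
  using assms
proof (induction b rule: dec_induct)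
  case (step b)
  then show ?case using dist_triangle[of "f a" "f (Suc b)" "f b"] by (simp add: sum.atLeastLessThan_Suc)
qed simp

text \<open>One fine grid point per coarse step may be chosen freely, so the worst point of every
  step can be taken, and a single gain in inscribed length bounds all these detours
  together.\<close>

lemma inscribed_length_refine:
  fixes M :: real and n q :: nat
  assumes "0 < q" "\<And>i. m i \<le> q"
  defines "u \<equiv> \<lambda>i. M * real (i * q + m i) / real (n * q)"
  shows "(\<Sum>i<n. dist (\<gamma> (M * real i / real n)) (\<gamma> (u i)) + dist (\<gamma> (u i)) (\<gamma> (M * real (Suc i) / real n)))
    \<le> inscribed_length \<gamma> M (n * q)"
proof -
  define f where "f j = \<gamma> (M * real j / real (n * q))" for j
  have f: "\<gamma> (M * real i / real n) = f (i * q)" for i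
    using assms(1) by (simp add: f_def field_simps)
  have "dist (\<gamma> (M * real i / real n)) (\<gamma> (u i)) + dist (\<gamma> (u i)) (\<gamma> (M * real (Suc i) / real n))
      \<le> (\<Sum>j\<in>{i * q..<i * q + q}. dist (f j) (f (Suc j)))" for i
  proof -
    have "dist (\<gamma> (M * real i / real n)) (\<gamma> (u i)) + dist (\<gamma> (u i)) (\<gamma> (M * real (Suc i) / real n)) =
        dist (f (i * q)) (f (i * q + m i)) + dist (f (i * q + m i)) (f (i * q + q))"
    proof -
      have "\<gamma> (u i) = f (i * q + m i)" by (simp only: u_def f_def)
      moreover have "Suc i * q = i * q + q" by simp
      ultimately show ?thesis using f[of i] f[of "Suc i"] by (simp add: add.commute)
    qed
    also have "\<dots> \<le> (\<Sum>j\<in>{i * q..<i * q + m i}. dist (f j) (f (Suc j)))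
        + (\<Sum>j\<in>{i * q + m i..<i * q + q}. dist (f j) (f (Suc j)))"
      using assms(2)[of i] by (intro add_mono dist_le_sum_dist) auto
    also have "\<dots> = (\<Sum>j\<in>{i * q..<i * q + q}. dist (f j) (f (Suc j)))"
      using assms(2)[of i] by (intro sum.atLeastLessThan_concat) auto
    finally show ?thesis .
  qed
  then have "(\<Sum>i<n. dist (\<gamma> (M * real i / real n)) (\<gamma> (u i)) + dist (\<gamma> (u i)) (\<gamma> (M * real (Suc i) / real n)))
      \<le> (\<Sum>i<n. \<Sum>j\<in>{i * q..<i * q + q}. dist (f j) (f (Suc j)))"
    by (rule sum_mono)
  also have "\<dots> = inscribed_length \<gamma> M (n * q)"
    by (subst sum.nat_group) (simp add: inscribed_length_def f_def)
  finally show ?thesis .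
qed

text \<open>The gains of \<open>J\<close> successive refinements telescope to at most
  \<open>M\<close>, so they cannot all exceed \<eta>.\<close>

lemma inscribed_length_pigeonhole:
  assumes lip: "\<And>s t. dist (\<gamma> s) (\<gamma> t) \<le> \<bar>s - t\<bar>" and "0 \<le> M" "0 < n" "0 < q" "M < real J * \<eta>"
  obtains j where "j < J" "inscribed_length \<gamma> M (n * q ^ Suc j) - inscribed_length \<gamma> M (n * q ^ j) \<le> \<eta>"
proof -
  define S where "S j = inscribed_length \<gamma> M (n * q ^ j)" for j
  have "\<exists>j<J. S (Suc j) - S j \<le> \<eta>"
  proof (rule ccontr)
    assume "\<not> ?thesis"
    then have "(\<Sum>j<J. \<eta>) \<le> (\<Sum>j<J. S (Suc j) - S j)" by (intro sum_mono) auto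
    also have "\<dots> = S J - S 0" by (rule sum_lessThan_telescope)
    also have "\<dots> \<le> M"
      using inscribed_length_le[OF lip, of M "n * q ^ J"] inscribed_length_nonneg[of \<gamma> M n] assms
      by (simp add: S_def)
    finally show False using assms by simp
  qed
  then show thesis using that by (auto simp: S_def)
qed

text \<open>Some pair of consecutive scales \<open>n\<close>, \<open>n * q\<close> below a bound independent of \<open>\<gamma>\<close> captures the same
  length up to \<open>\<eta>\<close>. On it the radii \<open>r i\<close> are controlled by the excess of broken lines over chords
  (made linear by the arithmetic-geometric mean inequality with parameter \<open>\<theta>\<close>) and by terms of higher
  order in the step size \<open>h\<close>.\<close>

lemma curve_cover_by_finite:
  fixes M s \<epsilon> :: real
  assumes M: "M > 0" and s: "s > 0" and \<epsilon>: "\<epsilon> > 0"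
  shows "\<exists>\<delta>>0. \<forall>\<gamma> :: real \<Rightarrow> 'a::real_inner. (\<forall>s t. dist (\<gamma> s) (\<gamma> t) \<le> \<bar>s - t\<bar>) \<longrightarrow>
    (\<exists>(n::nat) a b r. (\<forall>i<n. a i \<in> range \<gamma> \<and> b i \<in> range \<gamma> \<and> 0 \<le> r i) \<and> (\<Sum>i<n. r i) \<le> \<epsilon> \<and>
      (\<forall>t\<in>{0..M}. \<forall>e. dist e (\<gamma> t) \<le> s + \<delta> \<longrightarrow>
         (\<exists>i<n. (dist e (a i))\<^sup>2 \<le> s\<^sup>2 + s * r i \<or> (dist e (b i))\<^sup>2 \<le> s\<^sup>2 + s * r i)))"
proof -
  \<comment> \<open>The sum of the radii has four contributions, each granted
    \<open>\<epsilon> / 4\<close>: \<open>2 * \<theta> * M\<close> fixes \<theta>,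
    \<open>\<eta> / \<theta>\<close> fixes \<eta>, \<open>6 * M / q\<close> fixes \<open>q\<close>,
    and \<open>M * h / (4 * s)\<close> is controlled by \<open>n0\<close>. The condition
    \<open>2 * (M / n0) \<le> s\<close> keeps the error in the distance at most
    \<open>s\<close>.\<close>
  define \<theta> where "\<theta> = \<epsilon> / (8 * M)"
  define \<eta> where "\<eta> = \<theta> * (\<epsilon> / 4)"
  have \<theta>: "\<theta> > 0" and \<eta>: "\<eta> > 0" using M \<epsilon> by (auto simp: \<theta>_def \<eta>_def)
  obtain J :: nat where "M / \<eta> < J" using reals_Archimedean2 by blast
  then have J: "M < real J * \<eta>" using \<eta> by (simp add: field_simps)
  obtain q :: nat where q': "max 1 (24 * M / \<epsilon>) < q" using reals_Archimedean2 by blast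
  then have q: "0 < q" "1 \<le> real q" and q24: "6 * M / q \<le> \<epsilon> / 4" using \<epsilon> by (auto simp: field_simps)
  obtain n0 :: nat where n0': "max 1 (max (M * M / (\<epsilon> * s)) (2 * M / s)) < n0"
    using reals_Archimedean2 by blast
  then have n0: "0 < n0" "M / n0 \<le> \<epsilon> * s / M" "2 * (M / n0) \<le> s"
    using \<epsilon> s M by (auto simp: field_simps)
  \<comment> \<open>At least as fine as the fine grid of every scale the pigeonhole may return, so
    that \<open>\<delta> \<le> h / q\<close> whichever it is.\<close>
  define \<delta> where "\<delta> = M / real (n0 * q ^ Suc J)"
  have \<delta>: "\<delta> > 0" using M n0 q by (simp add: \<delta>_def)
  show ?thesis
  proof (intro exI[of _ \<delta>] conjI allI impI \<delta>)
    fix \<gamma> :: "real \<Rightarrow> 'a"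
    assume "\<forall>s t. dist (\<gamma> s) (\<gamma> t) \<le> \<bar>s - t\<bar>"
    then have lip: "dist (\<gamma> s) (\<gamma> t) \<le> \<bar>s - t\<bar>" for s t by blast
    obtain j where j: "j < J"
      "inscribed_length \<gamma> M (n0 * q ^ Suc j) - inscribed_length \<gamma> M (n0 * q ^ j) \<le> \<eta>"
      using inscribed_length_pigeonhole[OF lip less_imp_le[OF M] n0(1) q(1) J] by blast
    define n where "n = n0 * q ^ j"
    define h where "h = M / n"
    define a where "a i = \<gamma> (M * real i / real n)" for i :: nat
    define b where "b i = \<gamma> (M * real (Suc i) / real n)" for i :: nat
    define g where "g k = \<gamma> (M * real k / real (n * q))" for k :: nat
    define D where "D i k = dist (a i) (g (i * q + k)) + dist (g (i * q + k)) (b i)" for i k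
    have n: "0 < n" "n0 \<le> n" using n0 q by (auto simp: n_def)
    have h: "0 < h" "n * h = M" using n M by (auto simp: h_def)
    have "h \<le> M / n0" unfolding h_def using n n0 M by (intro divide_left_mono) auto
    then have h_small: "h \<le> \<epsilon> * s / M" "2 * h \<le> s" using n0 by linarith+
    have hq: "h / q = M / real (n * q)" by (simp add: h_def)
    have "q ^ Suc j \<le> q ^ Suc J" using j q by (intro power_increasing) auto
    then have "n * q \<le> n0 * q ^ Suc J" by (simp add: n_def ac_simps)
    then have "real (n * q) \<le> real (n0 * q ^ Suc J)" by (simp only: of_nat_le_iff)
    moreover have "0 < real (n * q)" using n q by simp
    ultimately have \<delta>_le: "\<delta> \<le> h / q"
      unfolding \<delta>_def hq using M by (intro frac_le) auto
    have D_le: "D i k \<le> h" if "k \<le> q" for i k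
    proof -
      have 1: "M * real (i * q + k) / real (n * q) = M * real i / real n + h / q * real k"
        using n q by (simp add: h_def field_simps)
      have 2: "M * real (Suc i) / real n = M * real i / real n + h" using n by (simp add: h_def field_simps)
      have "h / q * real k \<le> h / q * real q" using that h by (intro mult_left_mono) auto
      also have "\<dots> = h" using q by simp
      finally have 3: "h / q * real k \<le> h" .
      have 4: "0 \<le> h / q * real k" using h by simp
      have "dist (a i) (g (i * q + k)) \<le> h / q * real k" "dist (g (i * q + k)) (b i) \<le> h - h / q * real k"
        unfolding a_def b_def g_def 1 2
        using lip[of "M * real i / real n" "M * real i / real n + h / q * real k"]
          lip[of "M * real i / real n + h / q * real k" "M * real i / real n + h"] 3 4 by auto
      then show ?thesis by (simp add: D_def)
    qed
    \<comment> \<open>\<open>m i\<close> marks the longest detour in step \<open>i\<close>, so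
      \<open>v i - c i\<close> controls the detour through every fine grid point of that
      step.\<close>
    have "\<exists>k\<le>q. \<forall>k'\<le>q. D i k' \<le> D i k" for i
    proof -
      have "Max (D i ` {..q}) \<in> D i ` {..q}" by (rule Max_in) auto
      then obtain k where "k \<le> q" "D i k = Max (D i ` {..q})"
        unfolding image_iff by (metis atMost_iff)
      then show ?thesis by (metis Max_ge atMost_iff finite_atMost finite_imageI imageI)
    qed
    then obtain m where m: "\<And>i. m i \<le> q" "\<And>i k. k \<le> q \<Longrightarrow> D i k \<le> D i (m i)" by metis
    define v where "v i = D i (m i)" for i
    define c where "c i = dist (a i) (b i)" for i
    have c_le: "c i \<le> D i k" for i k
      unfolding c_def D_def by (rule dist_triangle)
    have cv: "0 \<le> c i" "c i \<le> v i" "v i \<le> h" for i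
      using c_le D_le m by (auto simp: v_def c_def)
    have "(\<Sum>i<n. v i) \<le> inscribed_length \<gamma> M (n * q)"
      unfolding v_def D_def a_def b_def g_def by (rule inscribed_length_refine[OF q(1) m(1)])
    moreover have "(\<Sum>i<n. c i) = inscribed_length \<gamma> M n"
      by (simp add: c_def inscribed_length_def a_def b_def)
    moreover have "inscribed_length \<gamma> M (n * q) - inscribed_length \<gamma> M n \<le> \<eta>"
      using j(2) by (simp add: n_def ac_simps)
    ultimately have sum_vc: "(\<Sum>i<n. v i - c i) \<le> \<eta>"
      by (simp add: sum_subtractf)
    \<comment> \<open>A square root of the excess would not sum well over \<open>i\<close>; the
      bound \<open>4 * x * y \<le> (x + y)\<^sup>2\<close> replaces it by an expression linear in
      \<open>v i - c i\<close>. The terms of \<open>r\<close> are errors in the squared distance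
      divided by \<open>s\<close>: \<open>6 * h / q\<close> from a distance error
      \<open>2 * h / q\<close>, \<open>2 * \<sigma> i\<close> from a distance at most
      \<open>2 * s\<close>, and \<open>h\<^sup>2 / (4 * s)\<close> from half the broken
      line.\<close>
    define \<sigma> where "\<sigma> i = (v i - c i) / (2 * \<theta>) + \<theta> * h" for i
    define r where "r i = 6 * h / q + 2 * \<sigma> i + h\<^sup>2 / (4 * s)" for i
    have \<sigma>0: "0 \<le> \<sigma> i" for i using cv \<theta> h by (simp add: \<sigma>_def)
    have \<sigma>: "(v i)\<^sup>2 - (c i)\<^sup>2 \<le> (\<sigma> i)\<^sup>2" for i
    proof -
      have "(v i)\<^sup>2 - (c i)\<^sup>2 = (v i - c i) * (v i + c i)" by (simp add: power2_eq_square algebra_simps)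
      also have "\<dots> \<le> (v i - c i) * (2 * h)"
        using cv[of i] by (intro mult_left_mono) auto
      also have "\<dots> = 4 * ((v i - c i) / (2 * \<theta>)) * (\<theta> * h)" using \<theta> by (simp add: field_simps)
      also have "\<dots> \<le> (\<sigma> i)\<^sup>2"
      proof -
        have "4 * x * y \<le> (x + y)\<^sup>2" for x y :: real
          using sum_squares_bound[of x y] by (simp add: power2_sum)
        then show ?thesis unfolding \<sigma>_def .
      qed
      finally show ?thesis .
    qed
    show "\<exists>(n::nat) a b r. (\<forall>i<n. a i \<in> range \<gamma> \<and> b i \<in> range \<gamma> \<and> 0 \<le> r i) \<and> (\<Sum>i<n. r i) \<le> \<epsilon> \<and>
      (\<forall>t\<in>{0..M}. \<forall>e. dist e (\<gamma> t) \<le> s + \<delta> \<longrightarrow>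
         (\<exists>i<n. (dist e (a i))\<^sup>2 \<le> s\<^sup>2 + s * r i \<or> (dist e (b i))\<^sup>2 \<le> s\<^sup>2 + s * r i))"
    proof (rule exI[of _ n], rule exI[of _ a], rule exI[of _ b], rule exI[of _ r],
        intro conjI ballI allI impI)
      show "a i \<in> range \<gamma>" "b i \<in> range \<gamma>" for i by (auto simp: a_def b_def)
      show "0 \<le> r i" for i using h \<sigma>0 s by (simp add: r_def)
      have "(\<Sum>i<n. r i) = 6 * M / q + (\<Sum>i<n. v i - c i) / \<theta> + 2 * \<theta> * M + M * h / (4 * s)"
      proof -
        have "r i = 6 * h / q + (v i - c i) / \<theta> + 2 * \<theta> * h + h\<^sup>2 / (4 * s)" for i
          using \<theta> by (simp add: r_def \<sigma>_def field_simps)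
        then have "(\<Sum>i<n. r i) = 6 * (n * h) / q + (\<Sum>i<n. v i - c i) / \<theta> + 2 * \<theta> * (n * h) + (n * h) * h / (4 * s)"
          by (simp add: sum.distrib sum_divide_distrib power2_eq_square algebra_simps)
        then show ?thesis unfolding h(2) .
      qed
      also have "\<dots> \<le> \<epsilon> / 4 + \<epsilon> / 4 + \<epsilon> / 4 + \<epsilon> / 4"
      proof (intro add_mono q24)
        have "(\<Sum>i<n. v i - c i) / \<theta> \<le> \<eta> / \<theta>" using sum_vc \<theta> by (intro divide_right_mono) auto
        also have "\<dots> = \<epsilon> / 4" using \<theta> by (simp add: \<eta>_def)
        finally show "(\<Sum>i<n. v i - c i) / \<theta> \<le> \<epsilon> / 4" .
        show "2 * \<theta> * M \<le> \<epsilon> / 4" using M by (simp add: \<theta>_def)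
        have "M * h / (4 * s) \<le> M * (\<epsilon> * s / M) / (4 * s)"
          using h_small M s by (intro divide_right_mono mult_left_mono) auto
        also have "\<dots> = \<epsilon> / 4" using M s by simp
        finally show "M * h / (4 * s) \<le> \<epsilon> / 4" .
      qed
      finally show "(\<Sum>i<n. r i) \<le> \<epsilon>" by simp
    next
      fix t e
      assume t: "t \<in> {0..M}" and e: "dist e (\<gamma> t) \<le> s + \<delta>"
      define x where "x = t * real (n * q) / M"
      \<comment> \<open>The cap matters at \<open>t = M\<close>, where the floor is
        \<open>n * q\<close> and the coarse index would be \<open>n\<close>.\<close>
      define k where "k = min (n * q - 1) (nat \<lfloor>x\<rfloor>)"
      have nq: "0 < n * q" using n q by simp
      have x: "0 \<le> x" "x \<le> real (n * q)"
        using t M nq by (auto simp: x_def field_simps simp del: of_nat_mult intro!: mult_right_mono)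
      have k: "k < n * q" "real k \<le> x" "x \<le> real k + 1"
      proof -
        show "k < n * q" using nq unfolding k_def by linarith
        have fl: "real (nat \<lfloor>x\<rfloor>) \<le> x" "x \<le> real (nat \<lfloor>x\<rfloor>) + 1" using x(1) by linarith+
        have "k \<le> nat \<lfloor>x\<rfloor>" unfolding k_def by simp
        then show "real k \<le> x" using fl(1) by linarith
        show "x \<le> real k + 1"
        proof (cases "nat \<lfloor>x\<rfloor> \<le> n * q - 1")
          case True
          then have "k = nat \<lfloor>x\<rfloor>" unfolding k_def by simp
          then show ?thesis using fl by simp
        next
          case False
          then have "Suc k = n * q" using nq unfolding k_def by linarith
          then have "real k + 1 = real (n * q)" by (metis of_nat_Suc add.commute)
          then show ?thesis using x by simp
        qed
      qed
      have "t - M * real k / real (n * q) = (x - real k) * (M / real (n * q))"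
        using nq M by (simp add: x_def field_simps del: of_nat_mult)
      also have "\<bar>\<dots>\<bar> \<le> 1 * (M / real (n * q))"
        unfolding abs_mult using k M nq by (intro mult_mono) auto
      finally have "dist (\<gamma> t) (g k) \<le> h / q"
        using lip[of t "M * real k / real (n * q)"] by (simp add: g_def hq)
      \<comment> \<open>One \<open>h / q\<close> bounds \<delta>, the other the rounding of
        \<open>t\<close> to the fine grid.\<close>
      then have w: "dist e (g k) \<le> s + 2 * h / q"
        using e \<delta>_le dist_triangle[of e "g k" "\<gamma> t"] by simp
      define i where "i = k div q"
      define k' where "k' = k mod q"
      have i: "i < n" using k(1) by (simp add: i_def less_mult_imp_div_less)
      have k': "k' \<le> q" "k = i * q + k'" using q by (auto simp: i_def k'_def less_imp_le)
      define Q where "Q = (dist e (g k))\<^sup>2 + dist e (g k) * \<sigma> i + (D i k' / 2)\<^sup>2"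
      have D: "norm (a i - g k) + norm (b i - g k) = D i k'"
        by (simp add: D_def k'(2) dist_norm norm_minus_commute)
      have c: "norm (a i - g k - (b i - g k)) = c i" by (simp add: c_def dist_norm)
      have "(D i k')\<^sup>2 \<le> (v i)\<^sup>2"
        using m(2)[OF k'(1)] c_le[of i k'] cv(1)[of i] unfolding v_def by (intro power_mono) auto
      then have "(norm (a i - g k) + norm (b i - g k))\<^sup>2 - (norm (a i - g k - (b i - g k)))\<^sup>2 \<le> (\<sigma> i)\<^sup>2"
        unfolding D c using \<sigma>[of i] by linarith
      from near_endpoint[OF \<sigma>0 this, of "e - g k"]
      have "(dist e (a i))\<^sup>2 \<le> Q \<or> (dist e (b i))\<^sup>2 \<le> Q"
        unfolding D Q_def by (simp add: dist_norm)
      moreover have "Q \<le> s\<^sup>2 + s * r i"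
      proof -
        define \<tau> where "\<tau> = 2 * h / q"
        have "h / q \<le> h / 1" using h q by (intro divide_left_mono) auto
        then have \<tau>: "0 \<le> \<tau>" "\<tau> \<le> s" using h h_small by (auto simp: \<tau>_def)
        have "Q \<le> (s + \<tau>)\<^sup>2 + (s + s) * \<sigma> i + (h / 2)\<^sup>2"
          unfolding Q_def using w \<tau> \<sigma>0[of i] D_le[OF k'(1), of i] c_le[of i k'] cv(1)[of i]
          by (intro add_mono power_mono mult_right_mono) (auto simp: \<tau>_def)
        also have "(s + \<tau>)\<^sup>2 \<le> s\<^sup>2 + 3 * s * \<tau>"
          using mult_right_mono[OF \<tau>(2,1)] by (simp add: power2_eq_square algebra_simps)
        also have "s\<^sup>2 + 3 * s * \<tau> + (s + s) * \<sigma> i + (h / 2)\<^sup>2 = s\<^sup>2 + s * r i"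
          using s by (simp add: r_def \<tau>_def power2_eq_square field_simps)
        finally show ?thesis by simp
      qed
      ultimately show "\<exists>i<n. (dist e (a i))\<^sup>2 \<le> s\<^sup>2 + s * r i \<or> (dist e (b i))\<^sup>2 \<le> s\<^sup>2 + s * r i"
        using i by fastforce
    qed
  qed
qed

section \<open>Spikes at the subdivision points\<close>

text \<open>Finite and fixed in advance, since the spikes at one point must serve every
  \<open>e\<close> near it. Each vector has inner product at least half its norm with one of the
  axis directions; 0 serves the points already within \<open>s\<close>.\<close>

definition cross_directions :: "(real^2) set" where
  "cross_directions = {0, axis 1 1, - axis 1 1, axis 2 1, - axis 2 1}"

text \<open>A spike acts to first order: when \<open>norm w > s\<close>, a suitable direction lowers
  the squared distance by at least \<open>r * s - r\<^sup>2\<close>, which for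
  \<open>r \<le> s / 4\<close> covers the slack \<open>s * (r / 2)\<close>.\<close>

lemma cross_reaches:
  fixes a e :: "real^2"
  assumes "0 < s" "0 \<le> r" "r \<le> s / 4" and e: "(dist e a)\<^sup>2 \<le> s\<^sup>2 + s * (r / 2)"
  shows "\<exists>v\<in>cross_directions. dist e (a + r *\<^sub>R v) \<le> s"
proof (cases "dist e a \<le> s")
  case True
  then show ?thesis by (intro bexI[of _ 0]) (auto simp: cross_directions_def)
next
  case False
  define w where "w = e - a"
  have w: "norm w > s" "(norm w)\<^sup>2 \<le> s\<^sup>2 + s * (r / 2)" using False e by (auto simp: w_def dist_norm)
  have sq: "(norm w)\<^sup>2 = (w $ 1)\<^sup>2 + (w $ 2)\<^sup>2"
    unfolding power2_norm_eq_inner by (simp add: inner_vec_def sum_2 power2_eq_square)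
  have "\<exists>k. \<bar>w $ k\<bar> \<ge> norm w / 2"
  proof (rule ccontr)
    assume "\<not> ?thesis"
    then have "\<bar>w $ k\<bar> \<le> norm w / 2" for k by (simp add: not_le less_imp_le)
    then have "(w $ k)\<^sup>2 \<le> (norm w / 2)\<^sup>2" for k
      using abs_le_square_iff[of "w $ k" "norm w / 2"] by simp
    from add_mono[OF this[of 1] this[of 2]] have "(norm w)\<^sup>2 \<le> (norm w)\<^sup>2 / 2"
      unfolding sq[symmetric] by (simp add: power_divide)
    moreover have "(norm w)\<^sup>2 > 0" using w assms by auto
    ultimately show False by simp
  qed
  then obtain k where k: "\<bar>w $ k\<bar> \<ge> norm w / 2" by blast
  define v where "v = sgn (w $ k) *\<^sub>R (axis k 1 :: real^2)"
  have wk: "w $ k \<noteq> 0" using k w assms by auto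
  then have v: "v \<in> cross_directions"
    using exhaust_2[of k] by (auto simp: v_def cross_directions_def sgn_real_def)
  have vv: "v \<bullet> v = 1" using wk by (simp add: v_def inner_axis_axis sgn_real_def)
  have wv: "w \<bullet> v = \<bar>w $ k\<bar>" by (simp add: v_def inner_axis abs_sgn mult.commute)
  have "(dist e (a + r *\<^sub>R v))\<^sup>2 = (norm (w - r *\<^sub>R v))\<^sup>2"
    by (simp add: dist_norm w_def algebra_simps)
  also have "\<dots> = (norm w)\<^sup>2 - 2 * r * \<bar>w $ k\<bar> + r\<^sup>2"
    unfolding power2_norm_eq_inner using vv wv
    by (simp add: inner_diff_left inner_diff_right inner_commute power2_eq_square algebra_simps)
  also have "\<dots> \<le> s\<^sup>2"
  proof -
    have "2 * r * (s / 2) \<le> 2 * r * \<bar>w $ k\<bar>" using k w assms by (intro mult_left_mono) auto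
    moreover have "r * r \<le> s / 4 * r" using assms by (intro mult_right_mono) auto
    moreover have "0 \<le> r * s" using assms by simp
    ultimately show ?thesis using w(2) by (simp add: power2_eq_square mult.commute)
  qed
  finally have "dist e (a + r *\<^sub>R v) \<le> s"
    by (rule power2_le_imp_le) (use assms in simp)
  then show ?thesis using v by blast
qed

lemma norm_cross_directions: "v \<in> cross_directions \<Longrightarrow> norm v \<le> 1"
  by (auto simp: cross_directions_def)

lemma spanning_length_le_finite_measure:
  fixes K :: "(real^2) set"
  assumes K: "closed K" "connected K" "K \<noteq> {}" and E: "E \<subseteq> closed_nbhd K s" and s: "s > 0"
    and L: "hausdorff_measure_1 K = ennreal L" "0 \<le> L" and e: "e > 0"
  shows "spanning_length E s \<le> ennreal (L + e)"
proof -
  obtain p where p: "p \<in> K" using K by blast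
  \<comment> \<open>Trees with a single terminal show that finite length forces boundedness, hence
    compactness and finite nets.\<close>
  have "dist p y \<le> L + 1" if y: "y \<in> K" for y
    using rooted_tree_le_hausdorff_measure_1[OF K(2) L p, of "{y}" 1] rooted_tree_dist_le[of "{y}" p] y
    by force
  then have "bounded K" unfolding bounded_def by blast
  then have "compact K" using K by (simp add: compact_eq_bounded_closed)
  \<comment> \<open>\<open>e\<close> is halved between tree and spikes.\<close>
  define M where "M = 2 * (L + e / 2)"
  have M: "M > 0" using L e by (simp add: M_def)
  define W where "W = cross_directions \<times> (UNIV :: bool set)"
  have W: "finite W" by (simp add: W_def cross_directions_def)
  \<comment> \<open>\<open>s / 8\<close> keeps the spike lengths \<open>2 * r i\<close> within
    \<open>s / 4\<close>; the other bound keeps all spikes together within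
    \<open>e / 2\<close>.\<close>
  define \<epsilon> where "\<epsilon> = min (s / 8) (e / (4 * (card W + 1)))"
  have \<epsilon>: "\<epsilon> > 0" using s e by (simp add: \<epsilon>_def add_pos_nonneg)
  obtain \<delta> where \<delta>: "\<delta> > 0" and cover: "\<forall>\<gamma> :: real \<Rightarrow> real^2. (\<forall>s t. dist (\<gamma> s) (\<gamma> t) \<le> \<bar>s - t\<bar>) \<longrightarrow>
    (\<exists>(n::nat) a b r. (\<forall>i<n. a i \<in> range \<gamma> \<and> b i \<in> range \<gamma> \<and> 0 \<le> r i) \<and> (\<Sum>i<n. r i) \<le> \<epsilon> \<and>
      (\<forall>t\<in>{0..M}. \<forall>e. dist e (\<gamma> t) \<le> s + \<delta> \<longrightarrow>
         (\<exists>i<n. (dist e (a i))\<^sup>2 \<le> s\<^sup>2 + s * r i \<or> (dist e (b i))\<^sup>2 \<le> s\<^sup>2 + s * r i)))"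
    using curve_cover_by_finite[OF M s \<epsilon>] by (elim exE conjE) (rule that)
  obtain Z where Z: "Z \<subseteq> K" "finite Z" "K \<subseteq> (\<Union>z\<in>Z. ball z \<delta>)"
    using compactE_image[OF \<open>compact K\<close>, of K "\<lambda>z. ball z \<delta>"] \<delta> by force
  have "\<exists>l. rooted_tree (insert p Z) p l \<and> l \<le> L + e / 2"
    using Z p e by (intro rooted_tree_le_hausdorff_measure_1[OF K(2) L]) auto
  then obtain l where l: "rooted_tree (insert p Z) p l" "l \<le> L + e / 2" by blast
  obtain \<gamma> where \<gamma>: "lipschitz_curve (2 * l) p p \<gamma>" "insert p Z \<subseteq> range \<gamma>"
    "hausdorff_measure_1 (range \<gamma>) \<le> ennreal l"
    using rooted_tree_tour[OF l(1)] by blast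
  have lip: "\<forall>s t. dist (\<gamma> s) (\<gamma> t) \<le> \<bar>s - t\<bar>" using \<gamma>(1) by (simp add: lipschitz_curve_def)
  obtain n :: nat and a b r where
    ab': "\<forall>i<n. a i \<in> range \<gamma> \<and> b i \<in> range \<gamma> \<and> 0 \<le> r i"
    and sum_r: "(\<Sum>i<n. r i) \<le> \<epsilon>"
    and cov: "\<forall>t\<in>{0..M}. \<forall>e. dist e (\<gamma> t) \<le> s + \<delta> \<longrightarrow>
         (\<exists>i<n. (dist e (a i))\<^sup>2 \<le> s\<^sup>2 + s * r i \<or> (dist e (b i))\<^sup>2 \<le> s\<^sup>2 + s * r i)"
    using cover[THEN spec, THEN mp, OF lip] by (elim exE conjE) (rule that)
  have ab: "a i \<in> range \<gamma>" "b i \<in> range \<gamma>" "0 \<le> r i" if "i < n" for i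
    using ab' that by auto
  define base where "base = (\<lambda>(i, v :: real^2, \<beta>). if \<beta> then a i else b i)"
  \<comment> \<open>Only half the spike length counts in \<open>cross_reaches\<close>, so a slack of
    \<open>s * r i\<close> calls for length \<open>2 * r i\<close>.\<close>
  define tip where "tip = (\<lambda>(i, v, \<beta>). base (i, v, \<beta>) + (2 * r i) *\<^sub>R v)"
  define I where "I = {..<n} \<times> W"
  \<comment> \<open>The tips alone cover \<open>E\<close>; \<open>p\<close> keeps \<open>X\<close>
    nonempty.\<close>
  define X where "X = insert p (tip ` I)"
  define T where "T = range \<gamma> \<union> (\<Union>k\<in>I. closed_segment (base k) (tip k))"
  have "finite I" using W by (simp add: I_def)
  have base: "base k \<in> range \<gamma>" if "k \<in> I" for k
    using that ab by (auto simp: base_def I_def)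
  have "closed T"
    unfolding T_def using \<open>finite I\<close> lipschitz_curve_range(2)[OF \<gamma>(1)]
    by (intro closed_Un closed_UN) (auto intro: compact_imp_closed)
  moreover have "connected T"
    unfolding T_def
  proof (rule connected_Un_UN)
    fix S assume "S \<in> (\<lambda>k. closed_segment (base k) (tip k)) ` I"
    then obtain k where "k \<in> I" "S = closed_segment (base k) (tip k)" by blast
    then show "connected S" "range \<gamma> \<inter> S \<noteq> {}"
      using base[of k] ends_in_segment(1)[of "base k" "tip k"] by blast+
  qed (rule lipschitz_curve_range(3)[OF \<gamma>(1)])
  moreover have "X \<subseteq> T" using \<gamma>(2) by (auto simp: X_def T_def)
  moreover have "E \<subseteq> closed_nbhd X s"
  proof
    fix x assume "x \<in> E"
    then have "infdist x K \<le> s" using E by (auto simp: closed_nbhd_def)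
    then obtain y where y: "y \<in> K" "dist x y \<le> s"
      using infdist_attains_inf[OF K(1,3), of x] by metis
    obtain z where z: "z \<in> Z" "dist z y < \<delta>" using y Z by auto
    obtain t where t: "t \<in> {0..2 * l}" "z = \<gamma> t"
      using z \<gamma>(2) lipschitz_curve_range(1)[OF \<gamma>(1)] by auto
    have "dist x (\<gamma> t) \<le> s + \<delta>"
      using y z t dist_triangle[of x z y] by (simp add: dist_commute)
    moreover have "t \<in> {0..M}" using t l by (auto simp: M_def)
    ultimately obtain i where i: "i < n"
      "(dist x (a i))\<^sup>2 \<le> s\<^sup>2 + s * r i \<or> (dist x (b i))\<^sup>2 \<le> s\<^sup>2 + s * r i"
      using cov by blast
    have "r i \<le> (\<Sum>i<n. r i)" using i ab by (intro member_le_sum) auto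
    then have ri: "0 \<le> 2 * r i" "2 * r i \<le> s / 4" using sum_r ab i by (auto simp: \<epsilon>_def)
    obtain v \<beta> where v: "v \<in> cross_directions" "dist x (tip (i, v, \<beta>)) \<le> s"
    proof (cases "(dist x (a i))\<^sup>2 \<le> s\<^sup>2 + s * r i")
      case True
      then show thesis
        using cross_reaches[OF s ri, of x "a i"] that[of _ True] by (auto simp: tip_def base_def)
    next
      case False
      then show thesis
        using cross_reaches[OF s ri, of x "b i"] i that[of _ False] by (auto simp: tip_def base_def)
    qed
    have "tip (i, v, \<beta>) \<in> X" using v i by (auto simp: X_def I_def W_def)
    then show "x \<in> closed_nbhd X s"
      using infdist_le[of "tip (i, v, \<beta>)" X x] v by (auto simp: closed_nbhd_def)
  qed
  ultimately have "spanning_length E s \<le> hausdorff_measure_1 T"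
    using \<open>finite I\<close> by (intro spanning_length_le[of X]) (auto simp: X_def)
  also have "\<dots> \<le> hausdorff_measure_1 (range \<gamma>) + hausdorff_measure_1 (\<Union>k\<in>I. closed_segment (base k) (tip k))"
    unfolding T_def by (rule hausdorff_measure_1_Un)
  also have "\<dots> \<le> ennreal l + (\<Sum>k\<in>I. ennreal (dist (base k) (tip k)))"
    using \<gamma>(3) \<open>finite I\<close>
    by (intro add_mono order_trans[OF hausdorff_measure_1_UN] sum_mono hausdorff_measure_1_closed_segment)
  also have "(\<Sum>k\<in>I. ennreal (dist (base k) (tip k))) = ennreal (\<Sum>k\<in>I. dist (base k) (tip k))"
    by simp
  also have "ennreal l + \<dots> = ennreal (l + (\<Sum>k\<in>I. dist (base k) (tip k)))"
    using rooted_tree_nonneg[OF l(1)] by (simp add: sum_nonneg)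
  also have "\<dots> \<le> ennreal (L + e)"
  proof (rule ennreal_leI)
    have "(\<Sum>k\<in>I. dist (base k) (tip k)) \<le> (\<Sum>k\<in>I. 2 * r (fst k))"
    proof (rule sum_mono)
      fix k assume "k \<in> I"
      then obtain i v \<beta> where k: "k = (i, v, \<beta>)" "i < n" "v \<in> cross_directions"
        by (auto simp: I_def W_def)
      then have "dist (base k) (tip k) = 2 * r i * norm v"
        using ab(3) by (simp add: tip_def dist_norm)
      also have "\<dots> \<le> 2 * r i * 1"
        using norm_cross_directions k ab(3) by (intro mult_left_mono) auto
      finally show "dist (base k) (tip k) \<le> 2 * r (fst k)" using k by simp
    qed
    also have "\<dots> = (\<Sum>i<n. \<Sum>w\<in>W. 2 * r i)"
      unfolding I_def by (subst sum.cartesian_product) (simp add: case_prod_unfold)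
    also have "\<dots> = 2 * card W * (\<Sum>i<n. r i)"
      by (simp add: sum_distrib_left ac_simps)
    also have "\<dots> \<le> 2 * card W * \<epsilon>" using sum_r by (intro mult_left_mono) auto
    also have "\<dots> \<le> 2 * (card W + 1) * (e / (4 * (card W + 1)))"
      using \<epsilon> by (intro mult_mono) (auto simp: \<epsilon>_def)
    also have "\<dots> = e / 2" by (simp add: field_simps)
    finally show "l + (\<Sum>k\<in>I. dist (base k) (tip k)) \<le> L + e" using l(2) by simp
  qed
  finally show ?thesis .
qed

theorem theorem3p7:
  fixes E :: "(real^2) set" and s :: real
  assumes "compact E" and "s > 0"
  shows "spanning_length E s = max_distance_length E s"
proof (rule antisym)
  show "spanning_length E s \<le> max_distance_length E s"
    unfolding max_distance_length_def
  proof (rule INF_greatest, clarify)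
    fix K :: "(real^2) set"
    assume K: "closed K" "connected K" "E \<subseteq> closed_nbhd K s"
    show "spanning_length E s \<le> hausdorff_measure_1 K"
    proof (cases "K = {}")
      case True
      \<comment> \<open>The neighbourhood of the empty set is empty, so \<open>K = {}\<close>
        competes only when \<open>E = {}\<close>; there a single point, of length 0, matches
        it.\<close>
      then have "E = {}" using K by (auto simp: closed_nbhd_def)
      then have "spanning_length E s \<le> hausdorff_measure_1 {0::real^2}"
        using spanning_length_le[of "{0}" E s "{0}"] by simp
      then show ?thesis by simp
    next
      case False
      show ?thesis
      proof (cases "hausdorff_measure_1 K" rule: ennreal_cases)
        case (real L)
        show ?thesis
        proof (rule ennreal_le_epsilon)
          fix e :: real assume "e > 0"
          then show "spanning_length E s \<le> hausdorff_measure_1 K + ennreal e"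
            using spanning_length_le_finite_measure[OF K(1,2) False K(3) assms(2) real(2,1) \<open>e > 0\<close>] real
            by simp
        qed
      qed simp
    qed
  qed
qed (rule max_distance_length_le_spanning_length)

end
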